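(* There is a lower semicomputable chronological contextual semimeasure $\nu$ such that iterative AINU is $\Sigma^0_3$-hard; that is, for the policy $\pi^*_\nu$ that is $\nu$-optimal according to the iterative value function and breaks ties in favor of the action $\alpha$, the set $\{(h,a):\pi^*_\nu(h)=a\}$ is $\Sigma^0_3$-hard.
   Context: The action set is $\mathcal{A}=\{\alpha,\beta\}$, and the percept set is $\mathcal{E}=\{0,1\}\times\{0,1\}$, a percept $e=(o,r)$ consisting of a binary observation $o$ and a binary reward $r$. A history is $\ae_{<t}=a_1e_1\ldots a_{t-1}e_{t-1}\in(\mathcal{A}\times\mathcal{E})^*$. Policies are deterministic maps from histories to actions, identified with their graphs, encoded computably as sets of natural numbers. A set $A\subseteq\mathbb{N}$ is $\Sigma^0_3$-hard if every $\Sigma^0_3$ set is many-one reducible to $A$. A chronological contextual semimeasure $\nu$ assigns to all equal-length $e_{1:t}\in\mathcal{E}^t$, $a_{1:t}\in\mathcal{A}^t$ a number $\nu(e_{1:t}\,\|\,a_{1:t})\in[0,1]$ with $\nu(\epsilon\,\|\,\epsilon)\le1$ and $\sum_{e_t\in\mathcal{E}}\nu(e_{1:t}\,\|\,a_{1:t})\le\nu(e_{<t}\,\|\,a_{<t})$; it is lower semicomputable if $\{(e_{1:t},a_{1:t},q):q\in\mathbb{Q},\ \nu(e_{1:t}\,\|\,a_{1:t})>q\}$ is recursively enumerable. The discount function $\gamma:\mathbb{N}\to\mathbb{R}_{\ge0}$ is computable and summable with $\Gamma_t:=\sum_{k\ge t}\gamma(k)>0$ for all $t$. The iterative value of $\pi$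 after history $\ae_{<t}$ (with $\nu(e_{<t}\,\|\,a_{<t})>0$) is $$W^\pi_\nu(\ae_{<t}):=\frac1{\Gamma_t}\lim_{m\to\infty}\sum_{e_{t:m}}\frac{\nu(e_{1:m}\,\|\,a_{1:m})}{\nu(e_{<t}\,\|\,a_{<t})}\sum_{k=t}^m\gamma(k)r_k,\qquad a_i:=\pi(\ae_{<i})\text{ for }i\ge t;$$ $W^\pi_\nu(\ae_{<t}a)$ is the same expression with $a_t:=a$ (and $\pi$ used afterwards), and $W^*_\nu(\cdot):=\sup_\pi W^\pi_\nu(\cdot)$. Iterative AINU is the policy maximizing $W$; with ties broken in favor of $\alpha$ it satisfies $\pi^*_\nu(h)=\alpha$ iff $W^*_\nu(h\alpha)\ge W^*_\nu(h\beta)$. *)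

theory Defs
  imports Complex_Main "HOL-Library.Nat_Bijection"
begin

section \<open>Computability\<close>

text \<open>Partial recursive functions on tuples of natural numbers: syntax and big-step evaluation.
  In \<open>PrimR f g\<close> the recursion argument comes first, and \<open>g\<close> receives the predecessor,
  the recursive value and the parameters; \<open>Mu f\<close> minimises over the first argument of \<open>f\<close>.\<close>

datatype recf =
    Zer
  | Succ
  | Prj nat
  | Cmp recf "recf list"
  | PrimR recf recf
  | Mu recf

inductive rec_eval :: "recf \<Rightarrow> nat list \<Rightarrow> nat \<Rightarrow> bool" where
  rec_Zer: "rec_eval Zer xs 0"
| rec_Succ: "rec_eval Succ [x] (Suc x)"
| rec_Prj: "i < length xs \<Longrightarrow> rec_eval (Prj i) xs (xs ! i)"
| rec_Cmp: "list_all2 (\<lambda>g y. rec_eval g xs y) gs ys \<Longrightarrow> rec_eval f ys z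
    \<Longrightarrow> rec_eval (Cmp f gs) xs z"
| rec_PrimR_0: "rec_eval f xs y \<Longrightarrow> rec_eval (PrimR f g) (0 # xs) y"
| rec_PrimR_Suc: "rec_eval (PrimR f g) (n # xs) r \<Longrightarrow> rec_eval g (n # r # xs) y
    \<Longrightarrow> rec_eval (PrimR f g) (Suc n # xs) y"
| rec_Mu: "rec_eval f (n # xs) 0 \<Longrightarrow> (\<forall>k<n. \<exists>y>0. rec_eval f (k # xs) y)
    \<Longrightarrow> rec_eval (Mu f) xs n"

definition total_recursive1 :: "(nat \<Rightarrow> nat) \<Rightarrow> bool" where
  "total_recursive1 f \<longleftrightarrow> (\<exists>p. \<forall>x. rec_eval p [x] (f x))"

definition total_recursive2 :: "(nat \<Rightarrow> nat \<Rightarrow> nat) \<Rightarrow> bool" where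
  "total_recursive2 f \<longleftrightarrow> (\<exists>p. \<forall>x y. rec_eval p [x, y] (f x y))"

definition decidable4 :: "(nat \<Rightarrow> nat \<Rightarrow> nat \<Rightarrow> nat \<Rightarrow> bool) \<Rightarrow> bool" where
  "decidable4 R \<longleftrightarrow> (\<exists>p. \<forall>x i j k. rec_eval p [x, i, j, k] (if R x i j k then 1 else 0))"

definition rec_enumerable :: "nat set \<Rightarrow> bool" where
  "rec_enumerable A \<longleftrightarrow> (\<exists>p. A = {x. \<exists>y. rec_eval p [x] y})"

definition Sigma03 :: "nat set \<Rightarrow> bool" where
  "Sigma03 A \<longleftrightarrow> (\<exists>R. decidable4 R \<and> A = {x. \<exists>i. \<forall>j. \<exists>k. R x i j k})"

definition many_one_reducible :: "nat set \<Rightarrow> nat set \<Rightarrow> bool" where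
  "many_one_reducible B A \<longleftrightarrow> (\<exists>f. total_recursive1 f \<and> (\<forall>x. x \<in> B \<longleftrightarrow> f x \<in> A))"

definition Sigma03_hard :: "nat set \<Rightarrow> bool" where
  "Sigma03_hard A \<longleftrightarrow> (\<forall>B. Sigma03 B \<longrightarrow> many_one_reducible B A)"

text \<open>A standard (surjective, non-injective) numbering of the rationals.\<close>

definition rat_of_code :: "nat \<Rightarrow> rat" where
  "rat_of_code n = (case prod_decode n of (p, d) \<Rightarrow> of_int (int_decode p) / of_nat (Suc d))"

definition computable_real_seq :: "(nat \<Rightarrow> real) \<Rightarrow> bool" where
  "computable_real_seq g \<longleftrightarrow>
     (\<exists>f. total_recursive2 f \<and> (\<forall>k n. \<bar>g k - of_rat (rat_of_code (f k n))\<bar> \<le> 1 / 2 ^ n))"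


section \<open>Histories and policies\<close>

datatype action = ActAlpha | ActBeta

text \<open>A percept is a pair of an observation bit and a reward bit.\<close>

type_synonym percept = "bool \<times> bool"
type_synonym history = "(action \<times> percept) list"
type_synonym policy = "history \<Rightarrow> action"
type_synonym env = "percept list \<Rightarrow> action list \<Rightarrow> real"

fun action_code :: "action \<Rightarrow> nat" where
  "action_code ActAlpha = 0"
| "action_code ActBeta = 1"

definition percept_code :: "percept \<Rightarrow> nat" where
  "percept_code e = prod_encode (of_bool (fst e), of_bool (snd e))"

definition percepts_code :: "percept list \<Rightarrow> nat" where
  "percepts_code es = list_encode (map percept_code es)"

definition actions_code :: "action list \<Rightarrow> nat" where
  "actions_code as = list_encode (map action_code as)"

definition history_code :: "history \<Rightarrow> nat" where
  "history_code h = list_encode (map (\<lambda>(a, e). prod_encode (action_code a, percept_code e)) h)"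

definition policy_graph_code :: "policy \<Rightarrow> nat set" where
  "policy_graph_code \<pi> = {prod_encode (history_code h, action_code a) | h a. \<pi> h = a}"


section \<open>Environments\<close>

text \<open>\<open>\<nu> es as\<close> is meaningful only for lists of equal length; all conditions are restricted to these.\<close>

definition chronological_semimeasure :: "env \<Rightarrow> bool" where
  "chronological_semimeasure \<nu> \<longleftrightarrow>
     (\<forall>es as. length es = length as \<longrightarrow> 0 \<le> \<nu> es as \<and> \<nu> es as \<le> 1) \<and>
     \<nu> [] [] \<le> 1 \<and>
     (\<forall>es as a. length es = length as \<longrightarrow> (\<Sum>e\<in>UNIV. \<nu> (es @ [e]) (as @ [a])) \<le> \<nu> es as)"

definition lower_semicomputable :: "env \<Rightarrow> bool" where
  "lower_semicomputable \<nu> \<longleftrightarrow>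
     rec_enumerable {prod_encode (percepts_code es, prod_encode (actions_code as, q)) | es as q.
       length es = length as \<and> \<nu> es as > of_rat (rat_of_code q)}"

definition env_prob :: "env \<Rightarrow> history \<Rightarrow> real" where
  "env_prob \<nu> h = \<nu> (map snd h) (map fst h)"


section \<open>Iterative value\<close>

definition discount :: "(nat \<Rightarrow> real) \<Rightarrow> nat \<Rightarrow> real" where
  "discount \<gamma> t = (\<Sum>k. \<gamma> (k + t))"

definition discount_function :: "(nat \<Rightarrow> real) \<Rightarrow> bool" where
  "discount_function \<gamma> \<longleftrightarrow>
     (\<forall>k. 0 \<le> \<gamma> k) \<and> computable_real_seq \<gamma> \<and> summable \<gamma> \<and> (\<forall>t. 0 < discount \<gamma> t)"

text \<open>Time steps are counted from 1, list positions from 0.\<close>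

definition reward :: "history \<Rightarrow> nat \<Rightarrow> real" where
  "reward h k = of_bool (snd (snd (h ! (k - 1))))"

text \<open>The history obtained from \<open>h\<close> when the next percepts are \<open>es\<close> and actions follow \<open>\<pi>\<close>.\<close>

primrec extend_history :: "policy \<Rightarrow> history \<Rightarrow> percept list \<Rightarrow> history" where
  "extend_history \<pi> h [] = h"
| "extend_history \<pi> h (e # es) = extend_history \<pi> (h @ [(\<pi> h, e)]) es"

text \<open>A history \<open>h\<close> of length \<open>t - 1\<close> is followed by percepts \<open>e\<^sub>t, \<dots>, e\<^sub>m\<close>. The limit always
  exists for a semimeasure and a discount function, and the value is only used if
  \<open>env_prob \<nu> h > 0\<close>.\<close>

definition iter_value :: "(nat \<Rightarrow> real) \<Rightarrow> env \<Rightarrow> policy \<Rightarrow> history \<Rightarrow> real" where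
  "iter_value \<gamma> \<nu> \<pi> h = (let t = Suc (length h) in
     1 / discount \<gamma> t * lim (\<lambda>m. \<Sum>es | length es = Suc m - t.
        env_prob \<nu> (extend_history \<pi> h es) / env_prob \<nu> h *
        (\<Sum>k = t..m. \<gamma> k * reward (extend_history \<pi> h es) k)))"

text \<open>Updating \<open>\<pi>\<close> at \<open>h\<close> changes only the action taken at time \<open>t\<close>,
  since all later histories are longer than \<open>h\<close>.\<close>

definition iter_action_value ::
    "(nat \<Rightarrow> real) \<Rightarrow> env \<Rightarrow> policy \<Rightarrow> history \<Rightarrow> action \<Rightarrow> real" where
  "iter_action_value \<gamma> \<nu> \<pi> h a = iter_value \<gamma> \<nu> (\<pi>(h := a)) h"

definition opt_iter_value :: "(nat \<Rightarrow> real) \<Rightarrow> env \<Rightarrow> history \<Rightarrow> real" where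
  "opt_iter_value \<gamma> \<nu> h = (SUP \<pi>. iter_value \<gamma> \<nu> \<pi> h)"

definition opt_iter_action_value :: "(nat \<Rightarrow> real) \<Rightarrow> env \<Rightarrow> history \<Rightarrow> action \<Rightarrow> real" where
  "opt_iter_action_value \<gamma> \<nu> h a = (SUP \<pi>. iter_action_value \<gamma> \<nu> \<pi> h a)"

text \<open>The policy is \<open>\<nu>\<close>-optimal for the iterative value and breaks ties in favour of the
  action \<open>\<alpha>\<close>. The value is undefined after histories of \<open>\<nu>\<close>-probability zero, where the
  policy is left unconstrained.\<close>

definition iterative_AINU :: "(nat \<Rightarrow> real) \<Rightarrow> env \<Rightarrow> policy \<Rightarrow> bool" where
  "iterative_AINU \<gamma> \<nu> \<pi> \<longleftrightarrow> (\<forall>h. 0 < env_prob \<nu> h \<longrightarrow>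
     iter_value \<gamma> \<nu> \<pi> h = opt_iter_value \<gamma> \<nu> h \<and>
     (\<pi> h = ActAlpha \<longleftrightarrow>
        opt_iter_action_value \<gamma> \<nu> h ActAlpha \<ge> opt_iter_action_value \<gamma> \<nu> h ActBeta))"

end

(* The iterative value only counts rewards on histories whose measure survives forever. With a
   deterministic lower semicomputable environment, survival for t steps is a Sigma_1 condition, survival
   forever is Pi_2, and the supremum over policies, which lets the agent choose a number i before the
   rewards start, contributes the leading existential quantifier. After the query for a Sigma_3 instance,
   action alpha is worth 0 and action beta is worth something positive iff a suitable i exists; since
   ties go to alpha, the optimal policy plays beta exactly on the positive instances. A universal
   evaluator for recursive functions makes one environment serve all Sigma_3 sets. *)

theory Submission
  imports Defs
begin

section \<open>Computable functions between coded types\<close>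

text \<open>Each surviving step must be semidecidable, while survival forever must check infinitely
  many instances \<open>j\<close>. Hence the number of instances checked grows with the time since
  the commitment. The policy never computes these checks: they sit in the loss of mass of the
  semimeasure, and the limit in the value discards everything earned on a path that dies later, so
  one missing confirmation costs all. Rewards start only at the commitment; otherwise postponing it
  forever would pay as well. Postponing it for finitely many steps is harmless: single weights of
  \<open>\<gamma>\<close> may vanish, but only the positivity of the tails
  \<open>discount \<gamma> t\<close> is used. Stage 0 is reserved as a losing move, so that
  \<open>ActAlpha\<close> right after a query is worth 0. The evaluator is a decidable check of
  finite derivations; the search for a derivation is exactly what lower semicomputability allows.
  Since hardness is claimed for every optimal policy, the existence of one is proved too, by letting
  a greedy policy compete with any other over longer and longer horizons.\<close>

lemma rec_eval_Cmp1: "rec_eval g xs y \<Longrightarrow> rec_eval f [y] z \<Longrightarrow> rec_eval (Cmp f [g]) xs z"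
  by (rule rec_Cmp[where ys = "[y]"]) auto

lemma rec_eval_Cmp2:
  "rec_eval g xs y \<Longrightarrow> rec_eval h xs y' \<Longrightarrow> rec_eval f [y, y'] z \<Longrightarrow> rec_eval (Cmp f [g, h]) xs z"
  by (rule rec_Cmp[where ys = "[y, y']"]) auto

lemma rec_eval_Prj: "i < length xs \<Longrightarrow> y = xs ! i \<Longrightarrow> rec_eval (Prj i) xs y"
  by (simp add: rec_Prj)

lemma rec_eval_const: "\<exists>p. \<forall>xs. rec_eval p xs c"
proof (induction c)
  case 0
  show ?case using rec_Zer by blast
next
  case (Suc c)
  then obtain p where "\<forall>xs. rec_eval p xs c" by blast
  then have "\<forall>xs. rec_eval (Cmp Succ [p]) xs (Suc c)"
    by (blast intro: rec_eval_Cmp1 rec_Succ)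
  then show ?case by blast
qed

lemma rec_eval_PrimR_iterate:
  assumes "rec_eval f xs (h 0)" and "\<And>n. rec_eval g (n # h n # xs) (h (Suc n))"
  shows "rec_eval (PrimR f g) (n # xs) (h n)"
  using assms by (induction n) (auto intro: rec_eval.intros)

lemma total_recursive2_comp:
  assumes F: "total_recursive2 F" and G: "total_recursive2 G" and H: "total_recursive2 H"
  shows "total_recursive2 (\<lambda>x y. F (G x y) (H x y))"
proof -
  obtain p q r where "\<And>x y. rec_eval p [x, y] (F x y)" "\<And>x y. rec_eval q [x, y] (G x y)"
    "\<And>x y. rec_eval r [x, y] (H x y)"
    using assms unfolding total_recursive2_def by blast
  then have "\<forall>x y. rec_eval (Cmp p [q, r]) [x, y] (F (G x y) (H x y))"
    by (blast intro: rec_eval_Cmp2)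
  then show ?thesis unfolding total_recursive2_def by blast
qed

lemma total_recursive2_comp1:
  assumes F: "total_recursive1 F" and G: "total_recursive2 G"
  shows "total_recursive2 (\<lambda>x y. F (G x y))"
proof -
  obtain p q where "\<And>x. rec_eval p [x] (F x)" "\<And>x y. rec_eval q [x, y] (G x y)"
    using assms unfolding total_recursive2_def total_recursive1_def by blast
  then have "\<forall>x y. rec_eval (Cmp p [q]) [x, y] (F (G x y))"
    by (blast intro: rec_eval_Cmp1)
  then show ?thesis unfolding total_recursive2_def by blast
qed

lemma total_recursive1_comp2:
  assumes F: "total_recursive2 F" and G: "total_recursive1 G" and H: "total_recursive1 H"
  shows "total_recursive1 (\<lambda>x. F (G x) (H x))"
proof -
  obtain p q r where "\<And>x y. rec_eval p [x, y] (F x y)" "\<And>x. rec_eval q [x] (G x)"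
    "\<And>x. rec_eval r [x] (H x)"
    using assms unfolding total_recursive2_def total_recursive1_def by blast
  then have "\<forall>x. rec_eval (Cmp p [q, r]) [x] (F (G x) (H x))"
    by (blast intro: rec_eval_Cmp2)
  then show ?thesis unfolding total_recursive1_def by blast
qed

lemma total_recursive1_comp:
  assumes "total_recursive1 F" "total_recursive1 G"
  shows "total_recursive1 (\<lambda>x. F (G x))"
proof -
  obtain p q where "\<And>x. rec_eval p [x] (F x)" "\<And>x. rec_eval q [x] (G x)"
    using assms unfolding total_recursive1_def by blast
  then have "\<forall>x. rec_eval (Cmp p [q]) [x] (F (G x))"
    by (blast intro: rec_eval_Cmp1)
  then show ?thesis unfolding total_recursive1_def by blast
qed

lemma total_recursive1_Suc: "total_recursive1 Suc"
  unfolding total_recursive1_def by (blast intro: rec_Succ)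

lemma total_recursive1_id: "total_recursive1 (\<lambda>x. x)"
  unfolding total_recursive1_def by (rule exI[of _ "Prj 0"]) (auto intro: rec_eval_Prj)

lemma total_recursive1_const: "total_recursive1 (\<lambda>x. c)"
  unfolding total_recursive1_def using rec_eval_const by blast

lemma total_recursive2_fst: "total_recursive2 (\<lambda>x y. x)"
  unfolding total_recursive2_def by (rule exI[of _ "Prj 0"]) (auto intro: rec_eval_Prj)

lemma total_recursive2_snd: "total_recursive2 (\<lambda>x y. y)"
  unfolding total_recursive2_def by (rule exI[of _ "Prj 1"]) (auto intro: rec_eval_Prj)

lemma total_recursive1_rec:
  assumes "total_recursive2 G" and "\<And>n. h (Suc n) = G n (h n)"
  shows "total_recursive1 h"
proof -
  obtain p where p: "\<And>xs. rec_eval p xs (h 0)" using rec_eval_const by blast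
  obtain q where q: "\<And>x y. rec_eval q [x, y] (G x y)"
    using assms(1) unfolding total_recursive2_def by blast
  have "rec_eval (PrimR p q) [n] (h n)" for n
    by (rule rec_eval_PrimR_iterate[where h = h]) (auto simp: p q assms(2))
  then show ?thesis unfolding total_recursive1_def by blast
qed

lemma total_recursive2_rec:
  assumes F: "total_recursive1 F" and G: "total_recursive2 G"
    and "\<And>x. h 0 x = F x" and "\<And>n x. h (Suc n) x = G (h n x) x"
  shows "total_recursive2 h"
proof -
  obtain p q where p: "\<And>x. rec_eval p [x] (F x)" and q: "\<And>x y. rec_eval q [x, y] (G x y)"
    using F G unfolding total_recursive1_def total_recursive2_def by blast
  have "rec_eval (PrimR p (Cmp q [Prj 1, Prj 2])) [n, x] (h n x)" for n x
    by (rule rec_eval_PrimR_iterate[where h = "\<lambda>n. h n x"])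
      (auto simp: p assms(3,4) intro!: rec_eval_Cmp2 rec_eval_Prj q)
  then show ?thesis unfolding total_recursive2_def by blast
qed

section \<open>Arithmetic and the pairing function\<close>

lemma total_recursive2_add: "total_recursive2 (+)"
  by (rule total_recursive2_rec[OF total_recursive1_id
        total_recursive2_comp1[OF total_recursive1_Suc total_recursive2_fst]]) auto

lemma total_recursive1_pred: "total_recursive1 (\<lambda>n. n - 1)"
  by (rule total_recursive1_rec[OF total_recursive2_fst]) auto

lemma total_recursive2_diff: "total_recursive2 (-)"
proof -
  \<comment> \<open>Primitive recursion runs over the first argument, so truncated subtraction is
    built with its arguments swapped.\<close>
  have "total_recursive2 (\<lambda>n x :: nat. x - n)"
    by (rule total_recursive2_rec[OF total_recursive1_id
        total_recursive2_comp1[OF total_recursive1_pred total_recursive2_fst]]) auto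
  from total_recursive2_comp[OF this total_recursive2_snd total_recursive2_fst]
  show ?thesis by simp
qed

lemma total_recursive1_triangle: "total_recursive1 triangle"
  by (rule total_recursive1_rec[OF total_recursive2_comp[OF total_recursive2_add
        total_recursive2_snd total_recursive2_comp1[OF total_recursive1_Suc total_recursive2_fst]]])
    simp

lemma total_recursive2_prod_encode: "total_recursive2 (\<lambda>x y. prod_encode (x, y))"
  using total_recursive2_comp[OF total_recursive2_add
      total_recursive2_comp1[OF total_recursive1_triangle total_recursive2_add] total_recursive2_fst]
  by (simp add: prod_encode_def)

lemma triangle_mono: "m \<le> n \<Longrightarrow> triangle m \<le> triangle n"
  by (induction n) (auto simp: le_Suc_eq)

lemma prod_decode_triangle: "n = triangle (fst (prod_decode n) + snd (prod_decode n)) + fst (prod_decode n)"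
proof -
  have "n = prod_encode (fst (prod_decode n), snd (prod_decode n))" by simp
  then show ?thesis unfolding prod_encode_def by (simp only: case_prod_conv)
qed

text \<open>The diagonal on which \<^term>\<open>n\<close> lies in the pairing function is found by minimisation.\<close>

lemma total_recursive1_diagonal: "total_recursive1 (\<lambda>n. fst (prod_decode n) + snd (prod_decode n))"
proof -
  \<comment> \<open>This is zero iff \<open>n < triangle (Suc s)\<close>; the least such
    \<open>s\<close> is the diagonal.\<close>
  have "total_recursive2 (\<lambda>s n. Suc n - triangle (Suc s))"
    by (intro total_recursive2_comp[OF total_recursive2_diff]
        total_recursive2_comp1[OF total_recursive1_Suc]
        total_recursive2_comp1[OF total_recursive1_triangle] total_recursive2_snd total_recursive2_fst)
  then obtain p where p: "\<And>s n. rec_eval p [s, n] (Suc n - triangle (Suc s))"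
    unfolding total_recursive2_def by blast
  have "rec_eval (Mu p) [n] (fst (prod_decode n) + snd (prod_decode n))" for n
  proof (rule rec_Mu)
    let ?s = "fst (prod_decode n) + snd (prod_decode n)"
    have n: "n = triangle ?s + fst (prod_decode n)"
      by (rule prod_decode_triangle)
    show "rec_eval p [?s, n] 0"
    proof -
      have "Suc n - triangle (Suc ?s) = 0"
        using n unfolding triangle_Suc by linarith
      then show ?thesis using p[of ?s n] by (simp only:)
    qed
    show "\<forall>k<?s. \<exists>y>0. rec_eval p [k, n] y"
    proof (intro allI impI)
      fix k assume "k < ?s"
      then have "triangle (Suc k) \<le> n"
        using triangle_mono[of "Suc k" ?s] n by linarith
      then have "0 < Suc n - triangle (Suc k)" by linarith
      then show "\<exists>y>0. rec_eval p [k, n] y" using p by blast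
    qed
  qed
  then show ?thesis unfolding total_recursive1_def by blast
qed

lemma total_recursive1_fst: "total_recursive1 (\<lambda>n. fst (prod_decode n))"
proof -
  have "fst (prod_decode n) = n - triangle (fst (prod_decode n) + snd (prod_decode n))" for n
  proof -
    have "n = triangle (fst (prod_decode n) + snd (prod_decode n)) + fst (prod_decode n)"
      by (rule prod_decode_triangle)
    then show ?thesis by linarith
  qed
  then show ?thesis
    using total_recursive1_comp2[OF total_recursive2_diff total_recursive1_id
        total_recursive1_comp[OF total_recursive1_triangle total_recursive1_diagonal]]
    by simp
qed

lemma total_recursive1_snd: "total_recursive1 (\<lambda>n. snd (prod_decode n))"
  using total_recursive1_comp2[OF total_recursive2_diff total_recursive1_diagonal total_recursive1_fst]
  by simp

section \<open>Computability of typed functions through codes\<close>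

class coded =
  fixes enc :: "'a \<Rightarrow> nat" and dec :: "nat \<Rightarrow> 'a"
  assumes dec_enc [simp]: "dec (enc x) = x"
begin

lemma enc_inject [simp]: "enc x = enc y \<longleftrightarrow> x = y"
  by (metis dec_enc)

end

instantiation nat :: coded
begin
definition enc_nat :: "nat \<Rightarrow> nat" where [simp]: "enc_nat n = n"
definition dec_nat :: "nat \<Rightarrow> nat" where [simp]: "dec_nat n = n"
instance by standard simp
end

instantiation bool :: coded
begin
definition enc_bool :: "bool \<Rightarrow> nat" where [simp]: "enc_bool b = of_bool b"
definition dec_bool :: "nat \<Rightarrow> bool" where [simp]: "dec_bool n \<longleftrightarrow> n \<noteq> 0"
instance by standard auto
end

instantiation action :: coded
begin
definition enc_action :: "action \<Rightarrow> nat" where [simp]: "enc_action = action_code"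
definition dec_action :: "nat \<Rightarrow> action" where
  [simp]: "dec_action n = (if n = 0 then ActAlpha else ActBeta)"
instance
proof
  show "dec (enc x) = x" for x :: action by (cases x) auto
qed
end

instantiation prod :: (coded, coded) coded
begin
definition enc_prod :: "'a \<times> 'b \<Rightarrow> nat" where
  [simp]: "enc_prod p = prod_encode (enc (fst p), enc (snd p))"
definition dec_prod :: "nat \<Rightarrow> 'a \<times> 'b" where
  [simp]: "dec_prod n = (dec (fst (prod_decode n)), dec (snd (prod_decode n)))"
instance by standard simp
end

instantiation list :: (coded) coded
begin
definition enc_list :: "'a list \<Rightarrow> nat" where "enc_list l = list_encode (map enc l)"
definition dec_list :: "nat \<Rightarrow> 'a list" where "dec_list n = map dec (list_decode n)"
instance by standard (simp add: enc_list_def dec_list_def o_def)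
end

lemma enc_Nil [simp]: "enc [] = 0"
  by (simp add: enc_list_def)

lemma enc_Cons [simp]: "enc (x # xs) = Suc (prod_encode (enc x, enc xs))"
  by (simp add: enc_list_def)

text \<open>Nothing is demanded on numbers that code no element, so a closure lemma only needs a
  recursive function that agrees with \<open>f\<close> on codes. Functions of several arguments are
  treated as functions of a pair.\<close>

definition computable :: "('a::coded \<Rightarrow> 'b::coded) \<Rightarrow> bool" where
  "computable f \<longleftrightarrow> (\<exists>p. \<forall>x. rec_eval p [enc x] (enc (f x)))"

named_theorems computable_intros

lemma computable_of_total_recursive1:
  assumes "total_recursive1 F" and "\<And>x. enc (f x) = F (enc x)"
  shows "computable f"
  using assms unfolding computable_def total_recursive1_def by metis

lemma computable_of_total_recursive2:
  assumes "total_recursive2 F" and "\<And>x. enc (f x) = F (enc (g x)) (enc (h x))"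
    and "computable g" and "computable h"
  shows "computable f"
proof -
  obtain p q r where "\<And>x y. rec_eval p [x, y] (F x y)" "\<And>x. rec_eval q [enc x] (enc (g x))"
    "\<And>x. rec_eval r [enc x] (enc (h x))"
    using assms unfolding total_recursive2_def computable_def by blast
  then have "\<forall>x. rec_eval (Cmp p [q, r]) [enc x] (enc (f x))"
    unfolding assms(2) by (blast intro: rec_eval_Cmp2)
  then show ?thesis unfolding computable_def by blast
qed

lemma computable_compose:
  assumes "computable f" and "computable g"
  shows "computable (\<lambda>x. f (g x))"
proof -
  obtain p q where "\<And>x. rec_eval p [enc x] (enc (f x))" "\<And>x. rec_eval q [enc x] (enc (g x))"
    using assms unfolding computable_def by blast
  then have "\<forall>x. rec_eval (Cmp p [q]) [enc x] (enc (f (g x)))"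
    by (blast intro: rec_eval_Cmp1)
  then show ?thesis unfolding computable_def by blast
qed

lemma computable_id [computable_intros]: "computable (\<lambda>x. x)"
  by (rule computable_of_total_recursive1[OF total_recursive1_id]) simp

lemma computable_const [computable_intros]: "computable (\<lambda>x. c)"
  by (rule computable_of_total_recursive1[OF total_recursive1_const]) simp

lemma computable_Pair [computable_intros]: "computable f \<Longrightarrow> computable g \<Longrightarrow> computable (\<lambda>x. (f x, g x))"
  by (rule computable_of_total_recursive2[OF total_recursive2_prod_encode, where g = f and h = g]) auto

lemma computable_fst [computable_intros]: "computable f \<Longrightarrow> computable (\<lambda>x. fst (f x))"
  by (rule computable_compose[of fst], rule computable_of_total_recursive1[OF total_recursive1_fst]) auto

lemma computable_snd [computable_intros]: "computable f \<Longrightarrow> computable (\<lambda>x. snd (f x))"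
  by (rule computable_compose[of snd], rule computable_of_total_recursive1[OF total_recursive1_snd]) auto

lemma computable_curry:
  assumes "computable (\<lambda>z. F (fst z) (snd z))" "computable f" "computable g"
  shows "computable (\<lambda>x. F (f x) (g x))"
  using computable_compose[OF assms(1) computable_Pair[OF assms(2,3)]] by simp

lemma computable_Suc [computable_intros]: "computable f \<Longrightarrow> computable (\<lambda>x. Suc (f x))"
  by (rule computable_compose[of Suc], rule computable_of_total_recursive1[OF total_recursive1_Suc]) auto

lemma computable_add [computable_intros]: "computable f \<Longrightarrow> computable g \<Longrightarrow> computable (\<lambda>x. f x + g x :: nat)"
  by (rule computable_of_total_recursive2[OF total_recursive2_add, where g = f and h = g]) auto

lemma computable_diff [computable_intros]: "computable f \<Longrightarrow> computable g \<Longrightarrow> computable (\<lambda>x. f x - g x :: nat)"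
  by (rule computable_of_total_recursive2[OF total_recursive2_diff, where g = f and h = g]) auto

lemma computable_prod_decode [computable_intros]: "computable f \<Longrightarrow> computable (\<lambda>x. prod_decode (f x))"
  by (rule computable_compose[of prod_decode], rule computable_of_total_recursive1[OF total_recursive1_id]) auto

lemma computable_list_decode [computable_intros]: "computable f \<Longrightarrow> computable (\<lambda>x. list_decode (f x))"
proof (rule computable_compose[of list_decode], rule computable_of_total_recursive1[OF total_recursive1_id])
  show "enc (list_decode n) = enc n" for n
    by (simp add: enc_list_def enc_nat_def[abs_def] del: enc_nat_def)
qed

lemma computable_enc [computable_intros]: "computable f \<Longrightarrow> computable (\<lambda>x. enc (f x))"
  by (rule computable_compose[of enc], rule computable_of_total_recursive1[OF total_recursive1_id]) auto


lemma computable_Cons [computable_intros]: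
  assumes "computable f" "computable g" shows "computable (\<lambda>x. f x # g x)"
proof -
  have "total_recursive2 (\<lambda>x y. Suc (prod_encode (x, y)))"
    by (rule total_recursive2_comp1[OF total_recursive1_Suc total_recursive2_prod_encode])
  then show ?thesis by (rule computable_of_total_recursive2[OF _ _ assms]) simp
qed

lemma computable_tl [computable_intros]: "computable f \<Longrightarrow> computable (\<lambda>x. tl (f x))"
proof (rule computable_compose[of tl])
  have "enc (tl l) = snd (prod_decode (enc l - 1))" for l :: "'b list"
  proof (cases l)
    case Nil
    \<comment> \<open>\<open>tl [] = []\<close>, and the formula agrees since \<open>0\<close> codes
      both \<open>[]\<close> and the pair \<open>(0, 0)\<close>.\<close>
    then show ?thesis using prod_encode_inverse[of "(0, 0)"] by (simp add: prod_encode_def)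
  qed simp
  then show "computable (tl :: 'b list \<Rightarrow> _)"
    by (rule computable_of_total_recursive1[OF
          total_recursive1_comp[OF total_recursive1_snd total_recursive1_pred]])
qed

lemma computable_hd [computable_intros]: "computable f \<Longrightarrow> computable (\<lambda>x. hd (f x))"
proof (rule computable_compose[of hd])
  \<comment> \<open>\<open>hd []\<close> is some fixed value, so its code can serve as the base
    value; the recursion only separates zero from successors.\<close>
  let ?h = "rec_nat (enc (hd [] :: 'b)) (\<lambda>m r. fst (prod_decode m))"
  have "enc (hd l) = ?h (enc l)" for l :: "'b list"
    by (cases l) auto
  moreover have "total_recursive1 ?h"
    by (rule total_recursive1_rec[OF total_recursive2_comp1[OF total_recursive1_fst total_recursive2_fst]])
      simp
  ultimately show "computable (hd :: 'b list \<Rightarrow> _)"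
    by (blast intro: computable_of_total_recursive1)
qed

text \<open>The typed form of primitive recursion, from which conditionals, folds and bounded
  quantifiers are derived.\<close>

lemma computable_funpow [computable_intros]:
  fixes F :: "'a::coded \<Rightarrow> 'b::coded \<Rightarrow> 'b"
  assumes "computable n" "computable (\<lambda>z. F (fst z) (snd z))" "computable a"
  shows "computable (\<lambda>x. (F x ^^ n x) (a x))"
proof -
  obtain pn pF pa pp where pn: "\<And>x. rec_eval pn [enc x] (n x)"
    and pF: "\<And>z. rec_eval pF [enc z] (enc (F (fst z) (snd z)))"
    and pa: "\<And>x. rec_eval pa [enc x] (enc (a x))"
    and pp: "\<And>x y. rec_eval pp [x, y] (prod_encode (x, y))"
    using assms total_recursive2_prod_encode unfolding computable_def total_recursive2_def enc_nat_def
    by metis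
  \<comment> \<open>The step program receives counter, current value and parameter in this order;
    \<open>Prj 2\<close> and \<open>Prj 1\<close> rebuild the pair that \<open>pF\<close>
    expects.\<close>
  define q where "q = PrimR pa (Cmp pF [Cmp pp [Prj 2, Prj 1]])"
  have "rec_eval q [k, enc x] (enc ((F x ^^ k) (a x)))" for k x
    unfolding q_def
  proof (rule rec_eval_PrimR_iterate[where h = "\<lambda>k. enc ((F x ^^ k) (a x))"])
    show "rec_eval pa [enc x] (enc ((F x ^^ 0) (a x)))" by (simp add: pa)
    fix k
    show "rec_eval (Cmp pF [Cmp pp [Prj 2, Prj 1]]) [k, enc ((F x ^^ k) (a x)), enc x]
        (enc ((F x ^^ Suc k) (a x)))"
      using pF[of "(x, (F x ^^ k) (a x))"]
      by (auto intro!: rec_eval_Cmp1[where f = pF] rec_eval_Cmp2[OF _ _ pp] rec_eval_Prj)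
  qed
  then have "\<forall>x. rec_eval (Cmp q [pn, Prj 0]) [enc x] (enc ((F x ^^ n x) (a x)))"
    using pn by (auto intro!: rec_eval_Cmp2 rec_eval_Prj)
  then show ?thesis unfolding computable_def by blast
qed

text \<open>A conditional is an iteration repeated at most once.\<close>

lemma computable_If [computable_intros]:
  assumes "computable P" "computable f" "computable g"
  shows "computable (\<lambda>x. if P x then f x else g x)"
proof -
  have "(if P x then f x else g x) = ((\<lambda>_. f x) ^^ enc (P x)) (g x)" for x by simp
  then show ?thesis
    by (simp only:) (intro computable_intros assms computable_compose[OF assms(2)])
qed

lemma computable_not [computable_intros]:
  assumes "computable P" shows "computable (\<lambda>x. \<not> P x)"
proof -
  have "(\<not> P x) = (if P x then False else True)" for x by simp
  then show ?thesis by (simp only:) (intro computable_intros assms)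
qed

lemma computable_conj [computable_intros]:
  assumes "computable P" "computable Q" shows "computable (\<lambda>x. P x \<and> Q x)"
proof -
  have "(P x \<and> Q x) = (if P x then Q x else False)" for x by simp
  then show ?thesis by (simp only:) (intro computable_intros assms)
qed

lemma computable_disj [computable_intros]:
  assumes "computable P" "computable Q" shows "computable (\<lambda>x. P x \<or> Q x)"
proof -
  have "(P x \<or> Q x) = (if P x then True else Q x)" for x by simp
  then show ?thesis by (simp only:) (intro computable_intros assms)
qed

lemma computable_imp [computable_intros]:
  assumes "computable P" "computable Q" shows "computable (\<lambda>x. P x \<longrightarrow> Q x)"
proof -
  have "(P x \<longrightarrow> Q x) = (if P x then Q x else True)" for x by simp
  then show ?thesis by (simp only:) (intro computable_intros assms)
qed

lemma computable_less [computable_intros]: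
  fixes f g :: "'a::coded \<Rightarrow> nat"
  assumes "computable f" "computable g"
  shows "computable (\<lambda>x. f x < g x)"
proof -
  have "(f x < g x) = ((\<lambda>_. True) ^^ (g x - f x)) False" for x
    by (cases "g x - f x") auto
  then show ?thesis by (simp only:) (intro computable_intros assms)
qed

lemma computable_le [computable_intros]:
  fixes f g :: "'a::coded \<Rightarrow> nat"
  assumes "computable f" "computable g"
  shows "computable (\<lambda>x. f x \<le> g x)"
  unfolding not_less[symmetric] by (intro computable_intros assms)

lemma computable_eq [computable_intros]:
  assumes "computable f" "computable g"
  shows "computable (\<lambda>x. f x = g x)"
proof -
  have "(f x = g x) = (enc (f x) \<le> enc (g x) \<and> enc (g x) \<le> enc (f x))" for x
    using enc_inject[of "f x" "g x"] by linarith
  then show ?thesis by (simp only:) (intro computable_intros assms)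
qed

section \<open>Folds, list operations and bounded quantifiers\<close>

lemma length_le_enc: "length l \<le> enc l"
proof (induction l)
  case (Cons x l)
  then show ?case using le_prod_encode_2[of "enc l" "enc x"] by simp
qed simp

text \<open>The iterated state holds the unread rest and the accumulator, and idles once the rest is
  empty. So the code of the list, which bounds its length, is a good enough iteration count before
  \<open>length\<close> is known to be computable.\<close>

lemma computable_foldl:
  assumes F: "computable (\<lambda>z. F (fst z) (fst (snd z)) (snd (snd z)))"
    and a: "computable a" and l: "computable l"
  shows "computable (\<lambda>x. foldl (F x) (a x) (l x))"
proof -
  define step where "step x st =
      (if fst st = [] then st else (tl (fst st), F x (snd st) (hd (fst st))))" for x st
  have step: "(step x ^^ k) (l, a) = (drop k l, foldl (F x) a (take k l))" for x k l a
  proof (induction k arbitrary: l a)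
    case (Suc k)
    have "(step x ^^ Suc k) (l, a) = (step x ^^ k) (step x (l, a))"
      by (simp only: funpow_Suc_right o_apply)
    also have "\<dots> = (drop (Suc k) l, foldl (F x) a (take (Suc k) l))"
      by (cases l) (simp_all add: step_def Suc.IH)
    finally show ?case .
  qed simp
  have "foldl (F x) (a x) (l x) = snd ((step x ^^ enc (l x)) (l x, a x))" for x
    by (simp add: step length_le_enc)
  moreover have "computable (\<lambda>z. step (fst z) (snd z))"
  proof -
    have "computable (\<lambda>z. F (fst z) (snd (snd z)) (hd (fst (snd z))))"
    proof -
      have "computable (\<lambda>z. (fst z, snd (snd z), hd (fst (snd z))))"
        by (intro computable_intros)
      from computable_compose[OF F this] show ?thesis by (simp only: fst_conv snd_conv)
    qed
    then show ?thesis
      unfolding step_def by (intro computable_intros)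
  qed
  then have "computable (\<lambda>x. snd ((step x ^^ enc (l x)) (l x, a x)))"
    by (intro computable_intros a l)
  ultimately show ?thesis by (simp only:)
qed

lemma computable_rev [computable_intros]:
  assumes "computable l" shows "computable (\<lambda>x. rev (l x))"
proof -
  have "rev xs = foldl (\<lambda>r y. y # r) [] xs" for xs :: "'b list"
    by (simp add: foldl_conv_fold rev_conv_fold)
  then show ?thesis by (simp only:) (intro computable_intros computable_foldl assms)
qed

lemma computable_map [computable_intros]:
  assumes "computable (\<lambda>z. F (fst z) (snd z))" "computable l"
  shows "computable (\<lambda>x. map (F x) (l x))"
proof -
  have *: "map (F x) xs = rev (foldl (\<lambda>r y. F x y # r) [] xs)" for x xs
    by (induction xs rule: rev_induct) auto
  show ?thesis
    unfolding * by (intro computable_intros computable_foldl computable_curry[OF assms(1)] assms)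
qed

lemma computable_append [computable_intros]:
  assumes "computable k" "computable l" shows "computable (\<lambda>x. k x @ l x)"
proof -
  have "xs @ ys = foldl (\<lambda>r y. y # r) ys (rev xs)" for xs ys :: "'b list"
    by (induction xs arbitrary: ys) auto
  then show ?thesis by (simp only:) (intro computable_intros computable_foldl assms)
qed

lemma computable_length [computable_intros]:
  assumes "computable l" shows "computable (\<lambda>x. length (l x))"
proof -
  have "length xs = foldl (\<lambda>n y. Suc n) 0 xs" for xs :: "'b list"
    by (induction xs rule: rev_induct) auto
  then show ?thesis by (simp only:) (intro computable_intros computable_foldl assms)
qed

lemma computable_drop [computable_intros]:
  assumes "computable n" "computable l" shows "computable (\<lambda>x. drop (n x) (l x))"
proof -
  have "drop k xs = (tl ^^ k) xs" for k and xs :: "'b list"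
    by (induction k) (simp_all add: drop_Suc tl_drop[symmetric])
  then show ?thesis by (simp only:) (intro computable_intros assms)
qed

lemma computable_take [computable_intros]:
  assumes "computable n" "computable l" shows "computable (\<lambda>x. take (n x) (l x))"
proof -
  have "take k xs = rev (drop (length xs - k) (rev xs))" for k and xs :: "'b list"
    by (cases "k \<le> length xs") (simp_all add: drop_rev)
  then show ?thesis by (simp only:) (intro computable_intros assms)
qed

lemma computable_replicate [computable_intros]:
  assumes "computable n" "computable a" shows "computable (\<lambda>x. replicate (n x) (a x))"
proof -
  have "replicate k y = ((#) y ^^ k) []" for k and y :: 'b
    by (induction k) auto
  then show ?thesis
    by (simp only:) (intro computable_intros computable_compose[OF assms(2)] assms)
qed

lemma computable_upt [computable_intros]:
  assumes "computable n" shows "computable (\<lambda>x. [0..<n x])"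
proof -
  \<comment> \<open>Built downwards, the list has its next entry as its current length.\<close>
  have "(((\<lambda>l. length l # l) ^^ k) []) = rev [0..<k]" for k
    by (induction k) auto
  then have "[0..<k] = rev (((\<lambda>l. length l # l) ^^ k) [])" for k
    by simp
  then show ?thesis by (simp only:) (intro computable_intros assms)
qed

lemma computable_Ball [computable_intros]:
  assumes "computable l" "computable (\<lambda>z. P (fst z) (snd z))"
  shows "computable (\<lambda>x. \<forall>y\<in>set (l x). P x y)"
proof -
  have *: "(\<forall>y\<in>set xs. P x y) = foldl (\<lambda>b y. b \<and> P x y) True xs" for x xs
    by (induction xs rule: rev_induct) auto
  show ?thesis
    unfolding * by (intro computable_intros computable_foldl computable_curry[OF assms(2)] assms)
qed

lemma computable_Bex [computable_intros]:
  assumes "computable l" "computable (\<lambda>z. P (fst z) (snd z))"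
  shows "computable (\<lambda>x. \<exists>y\<in>set (l x). P x y)"
proof -
  have *: "(\<exists>y\<in>A. Q y) = (\<not> (\<forall>y\<in>A. \<not> Q y))" for A :: "'b set" and Q by blast
  show ?thesis unfolding * by (intro computable_intros assms)
qed

lemma computable_all_less [computable_intros]:
  fixes n :: "'a::coded \<Rightarrow> nat"
  assumes "computable n" "computable (\<lambda>z. P (fst z) (snd z))"
  shows "computable (\<lambda>x. \<forall>i<n x. P x i)"
proof -
  have "(\<forall>i<n x. P x i) \<longleftrightarrow> (\<forall>i\<in>set [0..<n x]. P x i)" for x by (simp add: Ball_def)
  then show ?thesis by (simp only:) (intro computable_intros assms)
qed

lemma computable_ex_less [computable_intros]:
  fixes n :: "'a::coded \<Rightarrow> nat"
  assumes "computable n" "computable (\<lambda>z. P (fst z) (snd z))"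
  shows "computable (\<lambda>x. \<exists>i<n x. P x i)"
proof -
  have "(\<exists>i<n x. P x i) \<longleftrightarrow> (\<exists>i\<in>set [0..<n x]. P x i)" for x by (simp add: Bex_def)
  then show ?thesis by (simp only:) (intro computable_intros assms)
qed

text \<open>Computing \<open>dec\<close> means replacing a number by the code of the element it
  decodes to, possibly another number. This lets a search run through all numbers and still see only
  genuine codes.\<close>

lemma computable_dec_nat: "computable (dec :: nat \<Rightarrow> nat)"
  unfolding dec_nat_def[abs_def] by (rule computable_id)

lemma computable_dec_bool: "computable (dec :: nat \<Rightarrow> bool)"
  unfolding dec_bool_def[abs_def] by (intro computable_intros)

lemma computable_dec_action: "computable (dec :: nat \<Rightarrow> action)"
  unfolding dec_action_def[abs_def] by (intro computable_intros)

lemma computable_dec_prod: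
  assumes "computable (dec :: nat \<Rightarrow> 'a::coded)" "computable (dec :: nat \<Rightarrow> 'b::coded)"
  shows "computable (dec :: nat \<Rightarrow> 'a \<times> 'b)"
  unfolding dec_prod_def[abs_def] by (intro computable_intros assms[THEN computable_compose])

lemma computable_dec_list:
  assumes "computable (dec :: nat \<Rightarrow> 'a::coded)"
  shows "computable (dec :: nat \<Rightarrow> 'a list)"
  unfolding dec_list_def[abs_def] by (intro computable_intros assms[THEN computable_compose])

lemmas computable_dec = computable_dec_nat computable_dec_bool computable_dec_action
  computable_dec_prod computable_dec_list

section \<open>Determinism of evaluation and enumerable sets\<close>

lemma rec_eval_CmpE:
  assumes "rec_eval (Cmp f gs) xs z"
  obtains ys where "list_all2 (\<lambda>g y. rec_eval g xs y) gs ys" "rec_eval f ys z"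
  using assms by cases auto

inductive_cases rec_eval_Mu_cases: "rec_eval (Mu f) xs n"
inductive_cases rec_eval_base_cases: "rec_eval Zer xs n" "rec_eval Succ xs n" "rec_eval (Prj i) xs n"
inductive_cases rec_eval_PrimR_cases: "rec_eval (PrimR f g) (0 # xs) n" "rec_eval (PrimR f g) (Suc m # xs) n"

lemma rec_eval_MuE:
  assumes "rec_eval (Mu f) xs n"
  shows "rec_eval f (n # xs) 0" and "\<And>k. k < n \<Longrightarrow> \<exists>y>0. rec_eval f (k # xs) y"
  using assms by (auto elim: rec_eval_Mu_cases)

lemma rec_eval_functional: "rec_eval p xs y \<Longrightarrow> rec_eval p xs z \<Longrightarrow> y = z"
proof (induction arbitrary: z rule: rec_eval.induct)
  case (rec_Cmp xs gs ys f y)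
  from rec_Cmp.prems obtain zs where zs: "list_all2 (\<lambda>g y. rec_eval g xs y) gs zs" "rec_eval f zs z"
    by (rule rec_eval_CmpE)
  have "ys = zs"
    using rec_Cmp.IH(1) zs(1) unfolding list_all2_conv_all_nth by (auto intro!: nth_equalityI)
  with zs(2) rec_Cmp.IH show ?case by blast
next
  case (rec_Mu f n xs)
  note z = rec_eval_MuE[OF rec_Mu.prems]
  show ?case
  proof (rule linorder_cases[of n z])
    assume "n < z"
    then show ?thesis using z(2) rec_Mu.IH(1) by blast
  next
    assume "z < n"
    then show ?thesis using z(1) rec_Mu.IH(2) by blast
  qed
next
  case (rec_PrimR_Suc f g n xs r y)
  from rec_PrimR_Suc.prems show ?case
    by (rule rec_eval_PrimR_cases(2)) (use rec_PrimR_Suc.IH in blast)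
next
  case (rec_PrimR_0 f xs y g)
  from rec_PrimR_0.prems show ?case
    by (rule rec_eval_PrimR_cases(1)) (rule rec_PrimR_0.IH)
qed (auto elim: rec_eval_base_cases)

text \<open>One \<open>Mu\<close> search runs through codes of pairs of a candidate \<open>x\<close>
  and a witness \<open>w\<close>. The condition \<open>enc x = n\<close> is part of what is searched
  for, so inputs that are no codes make the search diverge.\<close>

lemma rec_enumerable_Ex:
  assumes P: "computable (\<lambda>z. P (fst z) (snd z))"
    and dec: "computable (dec :: nat \<Rightarrow> 'a::coded)" "computable (dec :: nat \<Rightarrow> 'w::coded)"
  shows "rec_enumerable {enc x | x :: 'a. \<exists>w :: 'w. P x w}"
proof -
  define Q where "Q m n \<longleftrightarrow> enc (dec (fst (prod_decode m)) :: 'a) = n \<and>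
      P (dec (fst (prod_decode m))) (dec (snd (prod_decode m)))" for m n
  \<comment> \<open>The negation is decided because \<open>Mu\<close> looks for a zero, and
    \<open>False\<close> has code 0.\<close>
  have "computable (\<lambda>z. \<not> Q (fst z) (snd z))"
    unfolding Q_def
    by (intro computable_intros computable_compose[OF dec(1)] computable_compose[OF dec(2)]
        computable_curry[OF P])
  then obtain q where "\<And>z. rec_eval q [enc z] (enc (\<not> Q (fst z) (snd z)))"
    unfolding computable_def by blast
  from this[of "(m, n)" for m n]
  have q: "rec_eval q [prod_encode (m, n)] (of_bool (\<not> Q m n))" for m n by simp
  obtain pp where pp: "\<And>x y. rec_eval pp [x, y] (prod_encode (x, y))"
    using total_recursive2_prod_encode unfolding total_recursive2_def by blast
  have q': "rec_eval (Cmp q [pp]) [m, n] (of_bool (\<not> Q m n))" for m n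
    by (rule rec_eval_Cmp1[OF pp q])
  have "{enc x | x :: 'a. \<exists>w :: 'w. P x w} = {n. \<exists>y. rec_eval (Mu (Cmp q [pp])) [n] y}"
  proof (intro Collect_cong iffI)
    fix n
    assume "\<exists>x :: 'a. n = enc x \<and> (\<exists>w :: 'w. P x w)"
    then obtain x w where "n = enc (x :: 'a)" "P x (w :: 'w)" by blast
    then have "Q (prod_encode (enc x, enc w)) n" by (simp add: Q_def)
    then have "Q (LEAST m. Q m n) n" by (rule LeastI)
    then have "rec_eval (Cmp q [pp]) [LEAST m. Q m n, n] 0"
      using q'[of "LEAST m. Q m n" n] by simp
    moreover have "rec_eval (Cmp q [pp]) [k, n] 1" if "k < (LEAST m. Q m n)" for k
      using q'[of k n] not_less_Least[OF that] by simp
    ultimately have "rec_eval (Mu (Cmp q [pp])) [n] (LEAST m. Q m n)"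
      by (intro rec_Mu) (use zero_less_one in blast)+
    then show "\<exists>y. rec_eval (Mu (Cmp q [pp])) [n] y" by blast
  next
    fix n
    assume "\<exists>y. rec_eval (Mu (Cmp q [pp])) [n] y"
    then obtain y where "rec_eval (Cmp q [pp]) [y, n] 0"
      using rec_eval_MuE(1) by blast
    then have "Q y n" using rec_eval_functional[OF q'[of y n]] by (cases "Q y n") auto
    then show "\<exists>x :: 'a. n = enc x \<and> (\<exists>w :: 'w. P x w)" unfolding Q_def by blast
  qed
  then show ?thesis unfolding rec_enumerable_def by blast
qed

section \<open>A universal evaluator\<close>

fun recf_code :: "recf \<Rightarrow> nat" where
  "recf_code Zer = enc (0 :: nat, 0 :: nat)"
| "recf_code Succ = enc (1 :: nat, 0 :: nat)"
| "recf_code (Prj i) = enc (2 :: nat, i)"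
| "recf_code (Cmp f gs) = enc (3 :: nat, recf_code f, list_encode (map recf_code gs))"
| "recf_code (PrimR f g) = enc (4 :: nat, recf_code f, recf_code g)"
| "recf_code (Mu f) = enc (5 :: nat, recf_code f)"

type_synonym judgement = "nat \<times> nat list \<times> nat"

text \<open>A judgement \<open>(c, xs, y)\<close> says that the program with code \<open>c\<close> evaluates \<open>xs\<close> to \<open>y\<close>. Data of a
  rule that its conclusion does not determine are read off a premise in \<open>A\<close>, so that the relation
  stays decidable for finite \<open>A\<close>.\<close>

definition justified :: "judgement \<Rightarrow> judgement set \<Rightarrow> bool" where
  "justified t A \<longleftrightarrow>
    (let c = fst t; xs = fst (snd t); y = snd (snd t); tag = fst (prod_decode c);
       d = snd (prod_decode c); f = fst (prod_decode d); g = snd (prod_decode d)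
     in tag = 0 \<and> y = 0 \<or>
       tag = 1 \<and> xs = [y - 1] \<and> 0 < y \<or>
       tag = 2 \<and> drop d xs = y # drop (Suc d) xs \<or>
       tag = 3 \<and> (\<exists>s\<in>A. fst s = f \<and> snd (snd s) = y \<and>
         length (fst (snd s)) = length (list_decode g) \<and>
         (\<forall>i<length (list_decode g). \<exists>r\<in>A. fst (snd r) = xs \<and>
           drop i (list_decode g) = fst r # drop (Suc i) (list_decode g) \<and>
           drop i (fst (snd s)) = snd (snd r) # drop (Suc i) (fst (snd s)))) \<or>
       tag = 4 \<and> (xs = 0 # tl xs \<and> (\<exists>s\<in>A. s = (f, tl xs, y)) \<or>
         (\<exists>s\<in>A. fst s = c \<and> xs = Suc (hd (fst (snd s))) # tl xs \<and>
           fst (snd s) = hd (fst (snd s)) # tl xs \<and>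
           (\<exists>r\<in>A. r = (g, hd (fst (snd s)) # snd (snd s) # tl xs, y)))) \<or>
       tag = 5 \<and> (\<exists>s\<in>A. s = (d, y # xs, 0)) \<and>
         (\<forall>k<y. \<exists>s\<in>A. fst s = d \<and> fst (snd s) = k # xs \<and> 0 < snd (snd s)))"

lemma computable_justified [computable_intros]:
  assumes "computable t" "computable l" shows "computable (\<lambda>x. justified (t x) (set (l x)))"
  unfolding justified_def Let_def by (intro computable_intros assms[THEN computable_compose] assms)

lemma justified_mono: "justified t A \<Longrightarrow> A \<subseteq> B \<Longrightarrow> justified t B"
  unfolding justified_def Let_def by (elim disj_forward; blast)

text \<open>Each judgement is justified by earlier ones. The state of the fold carries these along,
  so that \<open>computable_foldl\<close> applies.\<close>

definition derivation :: "judgement list \<Rightarrow> bool" where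
  "derivation D = fst (foldl (\<lambda>s t. (fst s \<and> justified t (set (snd s)), t # snd s)) (True, []) D)"

lemma computable_derivation [computable_intros]:
  "computable D \<Longrightarrow> computable (\<lambda>x. derivation (D x))"
  unfolding derivation_def by (intro computable_intros computable_foldl)

lemma derivation_Nil [simp]: "derivation []"
  by (simp add: derivation_def)

lemma derivation_snoc [simp]: "derivation (D @ [t]) \<longleftrightarrow> derivation D \<and> justified t (set D)"
proof -
  let ?step = "\<lambda>s t. (fst s \<and> justified t (set (snd s)), t # snd s)"
  have "snd (foldl ?step (True, []) D) = rev D"
    by (induction D rule: rev_induct) auto
  then show ?thesis by (simp add: derivation_def)
qed

lemma derivation_append: "derivation D \<Longrightarrow> derivation E \<Longrightarrow> derivation (D @ E)"
proof (induction E rule: rev_induct)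
  case (snoc t E)
  then show ?case
    using derivation_snoc[of "D @ E" t] justified_mono[of t "set E" "set (D @ E)"] by auto
qed simp

lemma finite_derivation:
  assumes "finite A" and "\<And>t. t \<in> A \<Longrightarrow> \<exists>D. derivation D \<and> t \<in> set D"
  shows "\<exists>D. derivation D \<and> A \<subseteq> set D"
  using assms
proof (induction A)
  case (insert t A)
  then obtain D E where "derivation D" "A \<subseteq> set D" "derivation E" "t \<in> set E"
    by (metis insertCI)
  then show ?case using derivation_append[of D E] by (intro exI[of _ "D @ E"]) auto
qed (auto intro: exI[of _ "[]"])

lemma derivation_intro:
  assumes "justified t A" "finite A" and "\<And>t. t \<in> A \<Longrightarrow> \<exists>D. derivation D \<and> t \<in> set D"
  shows "\<exists>D. derivation D \<and> t \<in> set D"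
proof -
  obtain D where "derivation D" "A \<subseteq> set D" using finite_derivation assms(2,3) by blast
  then show ?thesis
    using justified_mono[OF assms(1)] by (intro exI[of _ "D @ [t]"]) auto
qed

lemmas justified_simps = justified_def Let_def enc_prod_def enc_nat_def fst_conv snd_conv
  prod_encode_inverse list_encode_inverse list.sel

lemma justified_Cmp:
  assumes "(c, ys, z) \<in> A" and len: "length ys = length cs"
    and "\<And>i. i < length cs \<Longrightarrow> (cs ! i, xs, ys ! i) \<in> A"
  shows "justified (enc (3 :: nat, c, list_encode cs), xs, z) A"
proof -
  \<comment> \<open>An equation \<open>drop i l = a # drop (Suc i) l\<close> expresses
    \<open>l ! i = a\<close> and at the same time that \<open>i\<close> is in range.\<close>
  have "\<exists>r\<in>A. fst (snd r) = xs \<and> drop i cs = fst r # drop (Suc i) cs \<and>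
      drop i ys = snd (snd r) # drop (Suc i) ys" if "i < length cs" for i
    using that len assms(3)[OF that]
    by (intro bexI[of _ "(cs ! i, xs, ys ! i)"]) (simp_all only: fst_conv snd_conv Cons_nth_drop_Suc)
  then have "\<exists>s\<in>A. fst s = c \<and> snd (snd s) = z \<and> length (fst (snd s)) = length cs \<and>
      (\<forall>i<length cs. \<exists>r\<in>A. fst (snd r) = xs \<and> drop i cs = fst r # drop (Suc i) cs \<and>
        drop i (fst (snd s)) = snd (snd r) # drop (Suc i) (fst (snd s)))"
    using len by (intro bexI[OF _ assms(1)]) simp
  then show ?thesis
    by (simp only: justified_simps simp_thms)
qed

lemma justified_PrimR_0:
  assumes "(c, xs, y) \<in> A"
  shows "justified (enc (4 :: nat, c, d), 0 # xs, y) A"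
proof -
  have "\<exists>s\<in>A. s = (c, xs, y)" using assms by blast
  then show ?thesis by (simp only: justified_simps simp_thms)
qed

lemma justified_PrimR_Suc:
  assumes "(enc (4 :: nat, c, d), n # xs, r) \<in> A" "(d, n # r # xs, y) \<in> A"
  shows "justified (enc (4 :: nat, c, d), Suc n # xs, y) A"
proof -
  have "\<exists>s\<in>A. fst s = enc (4 :: nat, c, d) \<and> Suc n # xs = Suc (hd (fst (snd s))) # xs \<and>
      fst (snd s) = hd (fst (snd s)) # xs \<and>
      (\<exists>r\<in>A. r = (d, hd (fst (snd s)) # snd (snd s) # xs, y))"
    using assms(2) by (intro bexI[OF _ assms(1)]) simp
  then show ?thesis by (simp only: justified_simps simp_thms)
qed

lemma justified_Mu:
  assumes "(c, n # xs, 0) \<in> A" "\<And>k. k < n \<Longrightarrow> \<exists>y>0. (c, k # xs, y) \<in> A"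
  shows "justified (enc (5 :: nat, c), xs, n) A"
proof -
  have "\<forall>k<n. \<exists>s\<in>A. fst s = c \<and> fst (snd s) = k # xs \<and> 0 < snd (snd s)"
    using assms(2) by (metis fst_conv snd_conv)
  moreover have "\<exists>s\<in>A. s = (c, n # xs, 0)" using assms(1) by blast
  ultimately show ?thesis by (simp only: justified_simps simp_thms) blast
qed

text \<open>Every instance of an evaluation rule has finitely many premises, even for
  \<open>Mu\<close>, so the derivations of the premises can be concatenated and the conclusion
  appended.\<close>

lemma derivation_complete:
  "rec_eval p xs y \<Longrightarrow> \<exists>D. derivation D \<and> (recf_code p, xs, y) \<in> set D"
proof (induction rule: rec_eval.induct)
  case (rec_Zer xs)
  show ?case by (rule derivation_intro[of _ "{}"]) (auto simp: justified_def)
next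
  case (rec_Succ x)
  show ?case by (rule derivation_intro[of _ "{}"]) (auto simp: justified_def)
next
  case (rec_Prj i xs)
  then have "drop i xs = xs ! i # drop (Suc i) xs" by (simp only: Cons_nth_drop_Suc)
  then have "justified (recf_code (Prj i), xs, xs ! i) {}"
    by (simp only: justified_simps recf_code.simps simp_thms)
  then show ?case by (rule derivation_intro) simp_all
next
  case (rec_Cmp xs gs ys f z)
  let ?r = "\<lambda>i. (recf_code (gs ! i), xs, ys ! i)"
  have len: "length gs = length ys" using rec_Cmp(1) by (rule list_all2_lengthD)
  show ?case
  proof (rule derivation_intro)
    show "justified (recf_code (Cmp f gs), xs, z) (insert (recf_code f, ys, z) (?r ` {..<length gs}))"
      by (simp only: recf_code.simps, rule justified_Cmp) (auto simp: len)
  next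
    fix t assume "t \<in> insert (recf_code f, ys, z) (?r ` {..<length gs})"
    then show "\<exists>D. derivation D \<and> t \<in> set D"
      using rec_Cmp list_all2_nthD[OF rec_Cmp(1)] by auto
  qed simp
next
  case (rec_PrimR_0 f xs y g)
  show ?case
    by (rule derivation_intro[of _ "{(recf_code f, xs, y)}"])
      (use rec_PrimR_0 in \<open>auto simp: justified_PrimR_0 simp del: enc_prod_def\<close>)
next
  case (rec_PrimR_Suc f g n xs r y)
  show ?case
    by (rule derivation_intro[of _
          "{(recf_code (PrimR f g), n # xs, r), (recf_code g, n # r # xs, y)}"])
      (use rec_PrimR_Suc in \<open>auto intro: justified_PrimR_Suc simp del: enc_prod_def\<close>)
next
  case (rec_Mu f n xs)
  then obtain h where h: "\<And>k. k < n \<Longrightarrow> 0 < h k"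
    "\<And>k. k < n \<Longrightarrow> \<exists>D. derivation D \<and> (recf_code f, k # xs, h k) \<in> set D"
    by metis
  let ?A = "insert (recf_code f, n # xs, 0) ((\<lambda>k. (recf_code f, k # xs, h k)) ` {..<n})"
  show ?case
  proof (rule derivation_intro)
    show "justified (recf_code (Mu f), xs, n) ?A"
      unfolding recf_code.simps by (rule justified_Mu) (use h(1) in auto)
    show "\<exists>D. derivation D \<and> t \<in> set D" if "t \<in> ?A" for t
      using that rec_Mu.IH(1) h(2) by auto
  qed simp
qed

text \<open>Judgements about numbers that code no program may occur in \<open>D\<close> without
  harm: a judgement about a program is justified only by judgements about itself or its immediate
  subprograms. The tag in the code of \<open>p\<close> leaves one disjunct of
  \<open>justified\<close>.\<close>

lemma derivation_sound:
  "derivation D \<Longrightarrow> (recf_code p, xs, y) \<in> set D \<Longrightarrow> rec_eval p xs y"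
proof (induction D arbitrary: p xs y rule: rev_induct)
  case (snoc t D)
  have IH: "\<And>p xs y. (recf_code p, xs, y) \<in> set D \<Longrightarrow> rec_eval p xs y"
    using snoc by auto
  show ?case
  proof (cases "(recf_code p, xs, y) \<in> set D")
    case False
    then have J: "justified (recf_code p, xs, y) (set D)" using snoc.prems by auto
    show ?thesis
    proof (cases p)
      case Zer
      then show ?thesis using J by (auto simp: justified_def intro: rec_eval.intros)
    next
      case Succ
      then show ?thesis using J rec_Succ[of "y - 1"] by (auto simp: justified_def)
    next
      case (Prj i)
      then have *: "drop i xs = y # drop (Suc i) xs" using J by (auto simp: justified_def)
      then have "i < length xs" by (metis drop_all list.distinct(1) not_le)
      with * Prj show ?thesis by (auto intro!: rec_eval_Prj simp: Cons_nth_drop_Suc[symmetric])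
    next
      case (Cmp f gs)
      let ?cs = "map recf_code gs"
      obtain ys where f: "(recf_code f, ys, y) \<in> set D" and len: "length ys = length gs"
        and gs: "\<And>i. i < length gs \<Longrightarrow> \<exists>r\<in>set D. fst (snd r) = xs \<and>
          drop i ?cs = fst r # drop (Suc i) ?cs \<and> drop i ys = snd (snd r) # drop (Suc i) ys"
        using J unfolding Cmp by (auto simp: justified_def enc_list_def)
      have "rec_eval (gs ! i) xs (ys ! i)" if "i < length gs" for i
      proof (rule IH)
        have "drop i ?cs = recf_code (gs ! i) # drop (Suc i) ?cs"
          using that by (metis Cons_nth_drop_Suc length_map nth_map)
        moreover have "drop i ys = ys ! i # drop (Suc i) ys"
          using that len by (simp only: Cons_nth_drop_Suc)
        ultimately show "(recf_code (gs ! i), xs, ys ! i) \<in> set D"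
          using gs[OF that] by force
      qed
      then have "list_all2 (\<lambda>g y. rec_eval g xs y) gs ys"
        using len by (simp add: list_all2_conv_all_nth)
      then show ?thesis unfolding Cmp using IH[OF f] by (rule rec_Cmp)
    next
      case (PrimR f g)
      from J consider
          (zero) "xs = 0 # tl xs" "(recf_code f, tl xs, y) \<in> set D"
        | (suc) s where "s \<in> set D" "fst s = recf_code p" "xs = Suc (hd (fst (snd s))) # tl xs"
            "fst (snd s) = hd (fst (snd s)) # tl xs"
            "(recf_code g, hd (fst (snd s)) # snd (snd s) # tl xs, y) \<in> set D"
        unfolding PrimR by (auto simp: justified_def Let_def)
      then show ?thesis
      proof cases
        case zero
        then show ?thesis using rec_PrimR_0[OF IH] unfolding PrimR by metis
      next
        case suc
        then have "(recf_code p, hd (fst (snd s)) # tl xs, snd (snd s)) \<in> set D"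
          by (metis prod.collapse)
        from rec_PrimR_Suc[OF IH[OF this, unfolded PrimR] IH[OF suc(5)]] show ?thesis
          unfolding PrimR suc(3)[symmetric] .
      qed
    next
      case (Mu f)
      from J have *: "(recf_code f, y # xs, 0) \<in> set D"
        "\<forall>k<y. \<exists>s\<in>set D. fst s = recf_code f \<and> fst (snd s) = k # xs \<and> 0 < snd (snd s)"
        unfolding Mu by (simp_all add: justified_def Let_def)
      have "\<forall>k<y. \<exists>v>0. (recf_code f, k # xs, v) \<in> set D"
        using *(2) by (metis prod.collapse)
      with *(1) show ?thesis unfolding Mu by (blast intro: rec_Mu IH)
    qed
  qed (rule IH)
qed simp

text \<open>Stage \<open>i\<close> of the search for \<open>n = \<langle>c, x\<rangle>\<close>, where \<open>c\<close> is the code of a decider \<open>p\<close> of the matrix of a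
  \<open>\<Sigma>\<^sub>3\<close> predicate: a witness consists of \<open>k\<close> and a derivation of \<open>p (x, i - 1, j, k) = 1\<close>. There is
  no stage \<open>0\<close>.\<close>

definition confirms :: "nat \<Rightarrow> nat \<Rightarrow> nat \<Rightarrow> nat \<times> judgement list \<Rightarrow> bool" where
  "confirms n i j w \<longleftrightarrow> 0 < i \<and> derivation (snd w) \<and>
    (\<exists>s\<in>set (snd w). s = (fst (prod_decode n), [snd (prod_decode n), i - 1, j, fst w], 1))"

lemma computable_confirms [computable_intros]:
  assumes "computable n" "computable i" "computable j" "computable w"
  shows "computable (\<lambda>x. confirms (n x) (i x) (j x) (w x))"
  unfolding confirms_def One_nat_def
  by (intro computable_intros assms[THEN computable_compose] assms)

lemma ex_confirms:
  assumes "\<And>x i j k. rec_eval p [x, i, j, k] (if R x i j k then 1 else 0)"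
  shows "(\<exists>w. confirms (prod_encode (recf_code p, x)) i j w) \<longleftrightarrow> 0 < i \<and> (\<exists>k. R x (i - 1) j k)"
proof -
  have "R x i j k \<longleftrightarrow> rec_eval p [x, i, j, k] 1" for x i j k
    using assms[of x i j k] rec_eval_functional by (cases "R x i j k") fastforce+
  then have "R x i j k \<longleftrightarrow> (\<exists>D. derivation D \<and> (recf_code p, [x, i, j, k], 1) \<in> set D)" for x i j k
    using derivation_sound derivation_complete by blast
  then show ?thesis unfolding confirms_def by auto
qed

section \<open>The environment\<close>

text \<open>The actions \<open>\<beta>\<^sup>n \<alpha>\<close> pose query \<open>n\<close>, and the following \<open>\<beta>\<^sup>i \<alpha>\<close> commit to stage \<open>i\<close>. From then on every
  reward is 1, and the semimeasure drops to 0 as soon as some \<open>j\<close> smaller than the number of further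
  steps is not confirmed; this is a \<open>\<Sigma>\<^sub>1\<close> condition for each history and a \<open>\<Pi>\<^sub>2\<close> condition in the
  limit. Committing to stage 0, that is, playing \<open>\<alpha>\<close> right after the query, has value 0.\<close>

definition commit :: "nat \<Rightarrow> nat \<Rightarrow> action list" where
  "commit n i = replicate n ActBeta @ ActAlpha # replicate i ActBeta @ [ActAlpha]"

definition committed :: "action list \<Rightarrow> bool" where
  "committed as \<longleftrightarrow> (\<exists>n i s. as = commit n i @ s)"

text \<open>At most one decomposition of \<open>as\<close> exists, by
  \<open>commit_append_inject\<close>. Before and at the commitment nothing is checked; each later
  action adds one instance \<open>j\<close>.\<close>

definition alive :: "action list \<Rightarrow> bool" where
  "alive as \<longleftrightarrow> (\<forall>n i s. as = commit n i @ s \<longrightarrow> (\<forall>j<length s. \<exists>w. confirms n i j w))"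

text \<open>Observations carry no information. The reward for an action takes that action into
  account, so the committing action is already rewarded.\<close>

definition percepts :: "action list \<Rightarrow> percept list" where
  "percepts as = map (\<lambda>k. (False, committed (take (Suc k) as))) [0..<length as]"

definition search_env :: env where
  "search_env es as = of_bool (es = percepts as \<and> alive as)"

lemma length_commit [simp]: "length (commit n i) = n + i + 2"
  by (simp add: commit_def)

lemma replicate_beta_alpha_inject:
  "replicate n ActBeta @ ActAlpha # r = replicate m ActBeta @ ActAlpha # r' \<longleftrightarrow> n = m \<and> r = r'"
proof (induction n arbitrary: m)
  case 0
  show ?case by (cases m) auto
next
  case (Suc n)
  show ?case using Suc by (cases m) auto
qed

lemma commit_append_inject: "commit n i @ s = commit m k @ s' \<longleftrightarrow> n = m \<and> i = k \<and> s = s'"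
  by (simp add: commit_def replicate_beta_alpha_inject)

lemma committed_append: "committed as \<Longrightarrow> committed (as @ bs)"
  unfolding committed_def by (metis append_assoc)

lemma alive_appendD: "alive (as @ bs) \<Longrightarrow> alive as"
  unfolding alive_def by (metis append_assoc length_append trans_less_add1)

lemma alive_commit: "alive (commit n i @ s) \<longleftrightarrow> (\<forall>j<length s. \<exists>w. confirms n i j w)"
  by (auto simp: alive_def commit_append_inject)

text \<open>After the commitment only the number of further actions matters, not which ones they
  are.\<close>

lemma alive_committed:
  assumes "committed as" "length bs = length cs"
  shows "alive (as @ bs) \<longleftrightarrow> alive (as @ cs)"
  using assms by (auto simp: committed_def alive_commit)

lemma alive_uncommitted: "\<not> committed as \<Longrightarrow> alive as"
  unfolding committed_def alive_def by blast

lemma percepts_snoc: "percepts (as @ [a]) = percepts as @ [(False, committed (as @ [a]))]"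
  by (simp add: percepts_def)

lemma length_percepts [simp]: "length (percepts as) = length as"
  by (simp add: percepts_def)

lemma percepts_uncommitted:
  assumes "\<not> committed as"
  shows "percepts as = replicate (length as) (False, False)"
proof (rule nth_equalityI)
  fix k assume "k < length (percepts as)"
  moreover have "\<not> committed (take (Suc k) as)"
    using assms committed_append[of "take (Suc k) as" "drop (Suc k) as"] by auto
  ultimately show "percepts as ! k = replicate (length as) (False, False) ! k"
    by (simp add: percepts_def)
qed simp

lemma chronological_search_env: "chronological_semimeasure search_env"
proof -
  have "(\<Sum>e\<in>UNIV. search_env (es @ [e]) (as @ [a])) \<le> search_env es as" for es as a
  proof -
    \<comment> \<open>The next percept is forced, so one summand remains; mass can be lost only
      through \<open>alive\<close>.\<close>
    have "(\<Sum>e\<in>UNIV. search_env (es @ [e]) (as @ [a])) =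
        (\<Sum>e\<in>UNIV. if e = (False, committed (as @ [a]))
          then of_bool (es = percepts as \<and> alive (as @ [a])) else 0)"
      by (intro sum.cong) (auto simp: search_env_def percepts_snoc)
    also have "\<dots> = of_bool (es = percepts as \<and> alive (as @ [a]))"
      by (simp add: sum.delta)
    also have "\<dots> \<le> search_env es as"
      using alive_appendD[of as "[a]"] by (auto simp: search_env_def)
    finally show ?thesis .
  qed
  then show ?thesis by (auto simp: chronological_semimeasure_def search_env_def)
qed

section \<open>Lower semicomputability of the environment\<close>

lemma computable_commit [computable_intros]:
  "computable n \<Longrightarrow> computable i \<Longrightarrow> computable (\<lambda>x. commit (n x) (i x))"
  unfolding commit_def by (intro computable_intros)

text \<open>The bounded quantifiers make the condition decidable. No separate length test is needed:
  if \<open>as\<close> is too short, \<open>take\<close> returns a list shorter than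
  \<open>commit n i\<close>.\<close>

lemma committed_bounded:
  "committed as \<longleftrightarrow> (\<exists>n<length as. \<exists>i<length as. take (n + i + 2) as = commit n i)"
proof
  assume "committed as"
  then obtain n i s where "as = commit n i @ s" by (auto simp: committed_def)
  then have "n < length as" "i < length as" "take (n + i + 2) as = commit n i" by simp_all
  then show "\<exists>n<length as. \<exists>i<length as. take (n + i + 2) as = commit n i" by blast
next
  assume "\<exists>n<length as. \<exists>i<length as. take (n + i + 2) as = commit n i"
  then show "committed as" unfolding committed_def by (metis append_take_drop_id)
qed

text \<open>Collection: one finite list \<open>Z\<close> holds the witnesses for all the finitely
  many instances. This moves the unbounded quantifier to the front and leaves a decidable
  matrix.\<close>

lemma alive_bounded:
  "alive as \<longleftrightarrow> (\<exists>Z. \<forall>n<length as. \<forall>i<length as. \<forall>j<length as.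
    take (n + i + 2) as = commit n i \<and> n + i + 2 + j < length as \<longrightarrow> (\<exists>w\<in>set Z. confirms n i j w))"
proof
  assume alive: "alive as"
  define W where "W = (\<lambda>(n, i, j). SOME w. confirms n i j w)"
  obtain Z where Z: "set Z = W ` ({..<length as} \<times> {..<length as} \<times> {..<length as})"
    using finite_list[of "W ` ({..<length as} \<times> {..<length as} \<times> {..<length as})"] by auto
  have "\<exists>w\<in>set Z. confirms n i j w"
    if "n < length as" "i < length as" "j < length as" "take (n + i + 2) as = commit n i"
      "n + i + 2 + j < length as" for n i j
  proof
    have "as = commit n i @ drop (n + i + 2) as" using that(4) by (metis append_take_drop_id)
    moreover have "j < length (drop (n + i + 2) as)" using that(5) by simp
    ultimately have "\<exists>w. confirms n i j w" using alive unfolding alive_def by blast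
    then show "confirms n i j (W (n, i, j))" unfolding W_def by (simp add: someI_ex)
    show "W (n, i, j) \<in> set Z" unfolding Z using that by blast
  qed
  then show "\<exists>Z. \<forall>n<length as. \<forall>i<length as. \<forall>j<length as. take (n + i + 2) as = commit n i \<and>
      n + i + 2 + j < length as \<longrightarrow> (\<exists>w\<in>set Z. confirms n i j w)"
    by blast
next
  assume "\<exists>Z. \<forall>n<length as. \<forall>i<length as. \<forall>j<length as. take (n + i + 2) as = commit n i \<and>
      n + i + 2 + j < length as \<longrightarrow> (\<exists>w\<in>set Z. confirms n i j w)"
  then obtain Z where Z: "\<And>n i j. n < length as \<Longrightarrow> i < length as \<Longrightarrow> j < length as \<Longrightarrow>
      take (n + i + 2) as = commit n i \<Longrightarrow> n + i + 2 + j < length as \<Longrightarrow> \<exists>w\<in>set Z. confirms n i j w"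
    by blast
  show "alive as"
    unfolding alive_def
  proof (intro allI impI)
    fix n i s j assume "as = commit n i @ s" "j < length s"
    then show "\<exists>w. confirms n i j w" using Z[of n i j] by auto
  qed
qed

lemma computable_percepts [computable_intros]:
  "computable as \<Longrightarrow> computable (\<lambda>x. percepts (as x))"
  by (rule computable_compose[of percepts])
    (unfold percepts_def committed_bounded numeral_2_eq_2, intro computable_intros)

text \<open>\<open>int_decode\<close> maps even codes to nonnegative and odd codes to negative
  integers.\<close>

lemma rat_of_code_less_0: "rat_of_code q < 0 \<longleftrightarrow> odd (fst (prod_decode q))"
  by (auto simp: rat_of_code_def int_decode_def sum_decode_def divide_less_0_iff split: prod.splits)

lemma rat_of_code_less_1:
  assumes "even (fst (prod_decode q))"
  shows "rat_of_code q < 1 \<longleftrightarrow> fst (prod_decode q) < 2 * Suc (snd (prod_decode q))"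
proof -
  obtain p d where q: "prod_decode q = (p, d)" by force
  have "rat_of_code q < 1 \<longleftrightarrow> (rat_of_nat (p div 2) < of_nat (Suc d))"
    using assms by (simp add: rat_of_code_def int_decode_def sum_decode_def q divide_less_eq)
  also have "\<dots> \<longleftrightarrow> p div 2 < Suc d" by (rule of_nat_less_iff)
  finally show ?thesis using q by auto
qed

text \<open>All values are 0 or 1, so comparing them with a rational only needs the tests against 0
  and 1, the latter together with a certificate \<open>Z\<close> for \<open>alive\<close>.\<close>

lemma lower_semicomputable_search_env: "lower_semicomputable search_env"
proof -
  \<comment> \<open>Parity is spelled out with a bounded quantifier and a sum, the operations
    already known to be computable.\<close>
  define neg where "neg q \<longleftrightarrow> (\<exists>m<fst (prod_decode q). fst (prod_decode q) = Suc (m + m))" for q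
  have neg: "neg q \<longleftrightarrow> rat_of_code q < 0" for q
    unfolding neg_def rat_of_code_less_0 by presburger
  define A where "A as Z \<longleftrightarrow> (\<forall>n<length as. \<forall>i<length as. \<forall>j<length as.
      take (n + i + 2) as = commit n i \<and> n + i + 2 + j < length as \<longrightarrow>
      (\<exists>w\<in>set Z. confirms n i j w))" for as Z
  \<comment> \<open>The numeral test stands for \<open>rat_of_code q < 1\<close> only at nonnegative
    \<open>q\<close>; for the others the disjunct \<open>neg\<close> holds anyway.\<close>
  define P where "P x Z \<longleftrightarrow> length (fst x) = length (fst (snd x)) \<and>
      (neg (snd (snd x)) \<or> fst (prod_decode (snd (snd x))) <
        Suc (snd (prod_decode (snd (snd x)))) + Suc (snd (prod_decode (snd (snd x)))) \<and>
        fst x = percepts (fst (snd x)) \<and> A (fst (snd x)) Z)"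
    for x :: "percept list \<times> action list \<times> nat" and Z
  have "rec_enumerable {enc x | x. \<exists>Z. P x Z}"
    by (rule rec_enumerable_Ex; (intro computable_dec)?)
      (unfold P_def A_def neg_def numeral_2_eq_2, intro computable_intros)
  moreover have "search_env es as > of_rat (rat_of_code q) \<longleftrightarrow>
      rat_of_code q < 0 \<or> rat_of_code q < 1 \<and> es = percepts as \<and> alive as" for es as q
    by (auto simp: search_env_def)
  then have "(\<exists>Z. P (es, as, q) Z) \<longleftrightarrow>
      length es = length as \<and> search_env es as > of_rat (rat_of_code q)" for es as q
    using rat_of_code_less_1[of q] unfolding P_def neg alive_bounded A_def[symmetric]
    by (auto simp: rat_of_code_less_0 mult_2)
  moreover have "enc (es, as, q) = prod_encode (percepts_code es, prod_encode (actions_code as, q))"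
    for es :: "percept list" and as :: "action list" and q :: nat
    by (simp add: percepts_code_def actions_code_def enc_list_def percept_code_def[abs_def] enc_prod_def[abs_def])
  ultimately show ?thesis
    unfolding lower_semicomputable_def by (auto elim!: back_subst[of rec_enumerable])
qed

section \<open>Values of policies\<close>

abbreviation acts :: "history \<Rightarrow> action list" where
  "acts \<equiv> map fst"

text \<open>Appends the only percept with which \<open>search_env\<close> can answer the
  action.\<close>

definition advance :: "history \<Rightarrow> action \<Rightarrow> history" where
  "advance h a = h @ [(a, False, committed (acts h @ [a]))]"

primrec path :: "policy \<Rightarrow> history \<Rightarrow> nat \<Rightarrow> history" where
  "path \<pi> h 0 = h"
| "path \<pi> h (Suc k) = path \<pi> (advance h (\<pi> h)) k"

lemma length_advance [simp]: "length (advance h a) = Suc (length h)"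
  by (simp add: advance_def)

lemma acts_advance [simp]: "acts (advance h a) = acts h @ [a]"
  by (simp add: advance_def)

lemma length_path [simp]: "length (path \<pi> h k) = length h + k"
  by (induction k arbitrary: h) auto

lemma path_add: "path \<pi> h (k + l) = path \<pi> (path \<pi> h k) l"
  by (induction k arbitrary: h) auto

lemma path_Suc: "path \<pi> h (Suc k) = advance (path \<pi> h k) (\<pi> (path \<pi> h k))"
  using path_add[of \<pi> h k 1] by simp

lemma path_prefix: "\<exists>g. path \<pi> h k = h @ g"
proof (induction k arbitrary: h)
  case (Suc k)
  then obtain g where "path \<pi> (advance h (\<pi> h)) k = advance h (\<pi> h) @ g" by blast
  then show ?case by (simp add: advance_def)
qed simp

lemma acts_path: "\<exists>bs. acts (path \<pi> h k) = acts h @ bs \<and> length bs = k"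
proof -
  obtain g where g: "path \<pi> h k = h @ g" using path_prefix by blast
  have "length g = k" using arg_cong[OF g, of length] by simp
  with g show ?thesis by auto
qed

lemma percepts_path_iff:
  "map snd (path \<pi> h k) = percepts (acts (path \<pi> h k)) \<longleftrightarrow> map snd h = percepts (acts h)"
  by (induction k arbitrary: h) (auto simp: advance_def percepts_snoc)

lemma env_prob_search_env:
  "env_prob search_env h = of_bool (map snd h = percepts (acts h) \<and> alive (acts h))"
  by (simp add: env_prob_def search_env_def)

lemma env_prob_search_env_pos:
  "0 < env_prob search_env h \<longleftrightarrow> map snd h = percepts (acts h) \<and> alive (acts h)"
  by (simp add: env_prob_search_env)

lemma lists_length_Suc: "{es. length es = Suc n} = (\<lambda>(e, es). e # es) ` (UNIV \<times> {es. length es = n})"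
  by (force simp: length_Suc_conv)

text \<open>The environment is deterministic, so at most one continuation of each length contributes.\<close>

lemma sum_extend_history:
  "(\<Sum>es | length es = n. env_prob search_env (extend_history \<pi> h es) * F (extend_history \<pi> h es)) =
    env_prob search_env (path \<pi> h n) * F (path \<pi> h n)"
proof (induction n arbitrary: h)
  case (Suc n)
  let ?g = "\<lambda>h. env_prob search_env h * F h"
  have "(\<Sum>es | length es = Suc n. ?g (extend_history \<pi> h es)) =
      (\<Sum>(e, es)\<in>UNIV \<times> {es. length es = n}. ?g (extend_history \<pi> h (e # es)))"
    unfolding lists_length_Suc by (subst sum.reindex) (auto simp: inj_on_def case_prod_unfold)
  also have "\<dots> = (\<Sum>e\<in>UNIV. \<Sum>es | length es = n. ?g (extend_history \<pi> h (e # es)))"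
    by (simp add: sum.cartesian_product)
  also have "\<dots> = (\<Sum>e\<in>UNIV. ?g (path \<pi> (h @ [(\<pi> h, e)]) n))"
    by (simp add: Suc.IH)
  \<comment> \<open>A wrong percept is never repaired: by \<open>percepts_path_iff\<close> all its
    continuations have probability 0.\<close>
  also have "\<dots> = (\<Sum>e\<in>UNIV. if e = (False, committed (acts h @ [\<pi> h])) then ?g (path \<pi> (h @ [(\<pi> h, e)]) n) else 0)"
    by (intro sum.cong) (auto simp: env_prob_search_env percepts_path_iff percepts_snoc)
  also have "\<dots> = ?g (path \<pi> h (Suc n))"
    by (simp add: sum.delta advance_def)
  finally show ?case .
qed simp

lemma nth_path:
  assumes "l < n"
  shows "path \<pi> h n ! (length h + l) = (\<pi> (path \<pi> h l), False, committed (acts (path \<pi> h (Suc l))))"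
proof -
  obtain d where "n = Suc l + d" using assms less_imp_Suc_add by force
  then obtain g where "path \<pi> h n = path \<pi> h (Suc l) @ g" using path_prefix path_add by metis
  then show ?thesis unfolding path_Suc by (simp add: advance_def nth_append)
qed

section \<open>The iterative value in closed form\<close>

locale search_value =
  fixes \<gamma> :: "nat \<Rightarrow> real"
  assumes discount_function: "discount_function \<gamma>"
begin

lemma gamma_nonneg: "0 \<le> \<gamma> k" and summable_gamma: "summable \<gamma>" and discount_pos: "0 < discount \<gamma> t"
  using discount_function by (auto simp: discount_function_def)

lemma summable_gamma_shift: "summable (\<lambda>k. \<gamma> (t + k))"
  using summable_gamma by (simp add: summable_iff_shift add.commute)

lemma summable_gamma_of_bool: "summable (\<lambda>k. \<gamma> (t + k) * of_bool (P k))"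
  by (rule summable_comparison_test'[where N = 0, OF summable_gamma_shift[of t]]) (auto simp: gamma_nonneg)

text \<open>The value before division by \<open>discount\<close>. A path that dies is worth 0
  whatever was earned before, because every late term of the limit has probability 0.\<close>

definition raw_value :: "policy \<Rightarrow> history \<Rightarrow> real" where
  "raw_value \<pi> h = (if \<forall>k. alive (acts (path \<pi> h k))
    then \<Sum>k. \<gamma> (Suc (length h) + k) * of_bool (committed (acts (path \<pi> h (Suc k)))) else 0)"

lemma iter_value_search_env:
  assumes "0 < env_prob search_env h"
  shows "iter_value \<gamma> search_env \<pi> h = raw_value \<pi> h / discount \<gamma> (Suc (length h))"
proof -
  have h: "map snd h = percepts (acts h)" "env_prob search_env h = 1"
    using assms by (auto simp: env_prob_search_env)
  define T where "T = Suc (length h)"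
  define r where "r l = \<gamma> (T + l) * of_bool (committed (acts (path \<pi> h (Suc l))))" for l
  \<comment> \<open>The survival factor is taken at the horizon and multiplies all rewards up to it,
    unlike in a sum of expected rewards.\<close>
  define Y where "Y n = of_bool (alive (acts (path \<pi> h n))) * (\<Sum>l<n. r l)" for n
  have X: "(\<Sum>es | length es = Suc m - T. env_prob search_env (extend_history \<pi> h es) /
      env_prob search_env h * (\<Sum>k = T..m. \<gamma> k * reward (extend_history \<pi> h es) k)) =
      Y (m - length h)" for m
  proof -
    have "Suc m - T = m - length h" by (simp add: T_def)
    \<comment> \<open>Time \<open>k\<close> is list position \<open>k - 1\<close>, that is, offset
      \<open>k - T\<close> beyond \<open>h\<close>. For \<open>m \<le> length h\<close> both sums
      are empty.\<close>
    moreover have "(\<Sum>k = T..m. \<gamma> k * reward (path \<pi> h (m - length h)) k) = (\<Sum>l<m - length h. r l)"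
    proof (rule sum.reindex_bij_witness[of _ "\<lambda>l. T + l" "\<lambda>k. k - T"])
      fix k assume "k \<in> {T..m}"
      then have "k - 1 = length h + (k - T)" "k - T < m - length h" "T + (k - T) = k"
        by (auto simp: T_def)
      then show "r (k - T) = \<gamma> k * reward (path \<pi> h (m - length h)) k"
        using nth_path[of "k - T" "m - length h" \<pi> h] by (simp add: r_def reward_def)
    qed (auto simp: T_def)
    ultimately show ?thesis
      using sum_extend_history[where n = "m - length h" and \<pi> = \<pi> and h = h and
          F = "\<lambda>g. \<Sum>k = T..m. \<gamma> k * reward g k"] h
      by (simp add: Y_def env_prob_search_env percepts_path_iff)
  qed
  have "Y \<longlonglongrightarrow> raw_value \<pi> h"
  proof (cases "\<forall>k. alive (acts (path \<pi> h k))")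
    case True
    then have "Y = (\<lambda>n. \<Sum>l<n. r l)" by (simp add: fun_eq_iff Y_def)
    moreover have "summable r" unfolding r_def by (rule summable_gamma_of_bool)
    moreover have "raw_value \<pi> h = suminf r" using True unfolding raw_value_def r_def T_def by (simp only: simp_thms if_True)
    ultimately show ?thesis using summable_LIMSEQ[of r] by (simp only:)
  next
    case False
    then obtain k where k: "\<not> alive (acts (path \<pi> h k))" by blast
    have "Y n = 0" if "k \<le> n" for n
    proof -
      have "n = k + (n - k)" using that by simp
      then obtain bs where "acts (path \<pi> h n) = acts (path \<pi> h k) @ bs"
        using acts_path[of \<pi> "path \<pi> h k" "n - k"] by (metis path_add)
      then show ?thesis using k alive_appendD by (auto simp: Y_def)
    qed
    then have "Y \<longlonglongrightarrow> 0"
      by (intro tendsto_eventually) (auto simp: eventually_sequentially)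
    then show ?thesis using False unfolding raw_value_def by (simp only: if_False)
  qed
  then have "(\<lambda>m. Y (m - length h)) \<longlonglongrightarrow> raw_value \<pi> h"
    using LIMSEQ_offset[of "\<lambda>m. Y (m - length h)" "length h"] by simp
  then show ?thesis
    unfolding iter_value_def Let_def T_def[symmetric] X by (simp add: limI)
qed

lemma discount_eq: "discount \<gamma> t = (\<Sum>k. \<gamma> (t + k))"
  by (simp add: discount_def add.commute)

lemma suminf_gamma_of_bool_nonneg: "0 \<le> (\<Sum>k. \<gamma> (t + k) * of_bool (P k))"
  by (intro suminf_nonneg summable_gamma_of_bool) (simp add: gamma_nonneg)

lemma suminf_gamma_of_bool_le: "(\<Sum>k. \<gamma> (t + k) * of_bool (P k)) \<le> discount \<gamma> t"
  unfolding discount_eq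
  by (intro suminf_le summable_gamma_of_bool summable_gamma_shift) (simp add: gamma_nonneg)

lemma raw_value_nonneg: "0 \<le> raw_value \<pi> h"
  unfolding raw_value_def by (split if_split) (intro conjI impI suminf_gamma_of_bool_nonneg order_refl)

lemma raw_value_le: "raw_value \<pi> h \<le> discount \<gamma> (Suc (length h))"
  unfolding raw_value_def
  by (split if_split) (intro conjI impI suminf_gamma_of_bool_le less_imp_le discount_pos)

lemma always_alive_advance:
  "(\<forall>k. alive (acts (path \<pi> h k))) \<longleftrightarrow> (\<forall>k. alive (acts (path \<pi> (advance h (\<pi> h)) k)))"
proof
  assume alive: "\<forall>k. alive (acts (path \<pi> (advance h (\<pi> h)) k))"
  show "\<forall>k. alive (acts (path \<pi> h k))"
  proof
    show "alive (acts (path \<pi> h k))" for k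
      using alive[rule_format, of "k - 1"] alive[rule_format, of 0] alive_appendD
      by (cases k) auto
  qed
next
  assume "\<forall>k. alive (acts (path \<pi> h k))"
  then show "\<forall>k. alive (acts (path \<pi> (advance h (\<pi> h)) k))" by (metis path.simps(2))
qed

text \<open>No reward is due at this step, and later rewards are weighted by absolute time, so the
  unnormalised value does not change. The normalised one would pick up a ratio of discounts.\<close>

lemma raw_value_advance:
  assumes "\<not> committed (acts h @ [\<pi> h])"
  shows "raw_value \<pi> h = raw_value \<pi> (advance h (\<pi> h))"
proof -
  let ?r = "\<lambda>k. \<gamma> (Suc (length h) + k) * of_bool (committed (acts (path \<pi> h (Suc k))))"
  let ?h = "advance h (\<pi> h)"
  have "(\<Sum>k. ?r (Suc k)) = suminf ?r - ?r 0"
    by (rule suminf_split_head) (rule summable_gamma_of_bool)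
  moreover have "?r 0 = 0" using assms by simp
  moreover have "?r (Suc k) = \<gamma> (Suc (length ?h) + k) * of_bool (committed (acts (path \<pi> ?h (Suc k))))"
    for k by simp
  ultimately show ?thesis
    unfolding raw_value_def always_alive_advance[of \<pi> h] by (simp only: diff_0_right)
qed

lemma raw_value_path:
  "\<not> committed (acts (path \<pi> h k)) \<Longrightarrow> raw_value \<pi> h = raw_value \<pi> (path \<pi> h k)"
proof (induction k arbitrary: h)
  case (Suc k)
  obtain bs where "acts (path \<pi> h (Suc k)) = (acts h @ [\<pi> h]) @ bs"
    using acts_path[of \<pi> "advance h (\<pi> h)" k] by auto
  then have "\<not> committed (acts h @ [\<pi> h])"
    using Suc.prems committed_append[of "acts h @ [\<pi> h]" bs] by metis
  then show ?case using Suc raw_value_advance by simp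
qed simp

text \<open>From here on every step is rewarded and survival depends only on the number of steps.
  The value is all or nothing, and later choices of \<open>\<pi>\<close> cannot change it.\<close>

lemma raw_value_committed:
  assumes "committed (acts h @ [\<pi> h])"
  shows "raw_value \<pi> h = (if \<forall>bs. alive (acts h @ [\<pi> h] @ bs) then discount \<gamma> (Suc (length h)) else 0)"
proof -
  let ?h = "advance h (\<pi> h)"
  have "committed (acts (path \<pi> ?h k))" for k
    using acts_path[of \<pi> ?h k] committed_append[OF assms] by auto
  moreover have "(\<forall>k. alive (acts (path \<pi> ?h k))) \<longleftrightarrow> (\<forall>bs. alive (acts h @ [\<pi> h] @ bs))"
  proof -
    have "alive (acts (path \<pi> ?h (length bs))) \<longleftrightarrow> alive (acts h @ [\<pi> h] @ bs)" for bs
    proof -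
      obtain cs where "acts (path \<pi> ?h (length bs)) = (acts h @ [\<pi> h]) @ cs" "length cs = length bs"
        using acts_path[of \<pi> ?h "length bs"] by (auto simp del: append_assoc)
      then show ?thesis using alive_committed[OF assms, of cs bs] by simp
    qed
    moreover have "\<exists>bs. acts (path \<pi> ?h k) = acts h @ [\<pi> h] @ bs" for k
      using acts_path[of \<pi> ?h k] by auto
    ultimately show ?thesis by metis
  qed
  ultimately show ?thesis
    unfolding raw_value_def always_alive_advance[of \<pi> h] discount_eq by simp
qed

section \<open>Existence of an optimal policy\<close>

lemma discount_tendsto_0: "discount \<gamma> \<longlonglongrightarrow> 0"
  using suminf_exist_split[OF _ summable_gamma] by (auto simp: LIMSEQ_iff discount_def)

text \<open>Equals \<open>opt_iter_action_value\<close> at histories of positive probability, but is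
  meaningful at all histories, so that \<open>greedy\<close> and its optimality need no case
  distinction.\<close>

definition best :: "history \<Rightarrow> action \<Rightarrow> real" where
  "best h a = (SUP \<pi>. raw_value (\<pi>(h := a)) h / discount \<gamma> (Suc (length h)))"

lemma bdd_above_best:
  "bdd_above (range (\<lambda>\<pi>. raw_value (\<pi>(h := a)) h / discount \<gamma> (Suc (length h))))"
  by (rule bdd_aboveI[of _ 1]) (auto simp: divide_le_eq_1 discount_pos raw_value_le)

lemma raw_value_le_best:
  assumes "\<pi> h = a"
  shows "raw_value \<pi> h / discount \<gamma> (Suc (length h)) \<le> best h a"
proof -
  have "\<pi>(h := a) = \<pi>" using assms by auto
  then show ?thesis
    unfolding best_def using cSUP_upper[OF UNIV_I bdd_above_best, of \<pi> h a] by simp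
qed

lemma best_leI:
  assumes "\<And>\<pi>. \<pi> h = a \<Longrightarrow> raw_value \<pi> h \<le> c"
  shows "best h a \<le> c / discount \<gamma> (Suc (length h))"
  unfolding best_def
  by (rule cSUP_least) (auto intro!: divide_right_mono assms simp: less_imp_le discount_pos)

lemma best_pos_iff: "0 < best h a \<longleftrightarrow> (\<exists>\<pi>. \<pi> h = a \<and> 0 < raw_value \<pi> h)"
proof
  assume pos: "0 < best h a"
  show "\<exists>\<pi>. \<pi> h = a \<and> 0 < raw_value \<pi> h"
  proof (rule ccontr)
    assume "\<not> ?thesis"
    then have "best h a \<le> 0" using best_leI[of h a 0] by force
    with pos show False by simp
  qed
next
  assume "\<exists>\<pi>. \<pi> h = a \<and> 0 < raw_value \<pi> h"
  then show "0 < best h a"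
    using raw_value_le_best discount_pos by (metis divide_pos_pos less_le_trans)
qed

definition greedy :: policy where
  "greedy h = (if best h ActAlpha \<ge> best h ActBeta then ActAlpha else ActBeta)"

lemma best_le_greedy: "best h a \<le> best h (greedy h)"
  by (cases a) (auto simp: greedy_def)

text \<open>A policy can only gain on the greedy one if both remain uncommitted, so after \<open>k\<close> steps
  the advantage is at most the remaining discount.\<close>

lemma raw_value_le_greedy_add:
  "raw_value \<pi> h \<le> raw_value greedy h + discount \<gamma> (Suc (length h) + k)"
proof (induction k arbitrary: \<pi> h)
  case 0
  show ?case using raw_value_le[of \<pi> h] raw_value_nonneg[of greedy h] by simp
next
  case (Suc k)
  let ?d = "discount \<gamma> (Suc (length h))" and ?a = "greedy h"
  let ?c = "raw_value greedy h + discount \<gamma> (Suc (length h) + Suc k)"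
  \<comment> \<open>Policies that start greedily are enough, since the supremum over them,
    \<open>best h ?a\<close>, dominates every policy at \<open>h\<close>. For these, a committing
    step makes the values equal, and any other step leads to the induction hypothesis.\<close>
  have "raw_value \<pi>' h \<le> ?c" if "\<pi>' h = ?a" for \<pi>'
  proof (cases "committed (acts h @ [?a])")
    case True
    then have "raw_value \<pi>' h = raw_value greedy h"
      using raw_value_committed[of h \<pi>'] raw_value_committed[of h greedy] that by simp
    then show ?thesis using discount_pos[of "Suc (length h) + Suc k"] by simp
  next
    case False
    then show ?thesis
      using raw_value_advance[of h \<pi>'] raw_value_advance[of h greedy] that
        Suc.IH[of \<pi>' "advance h ?a"] by simp
  qed
  then have "best h ?a \<le> ?c / ?d" by (rule best_leI)
  with raw_value_le_best[of \<pi> h "\<pi> h"] best_le_greedy[of h "\<pi> h"]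
  have "raw_value \<pi> h / ?d \<le> ?c / ?d" by simp
  then show ?case using discount_pos[of "Suc (length h)"] by (simp add: divide_le_cancel)
qed

lemma raw_value_le_greedy: "raw_value \<pi> h \<le> raw_value greedy h"
proof (rule LIMSEQ_le_const)
  have "(\<lambda>k. discount \<gamma> (k + Suc (length h))) \<longlonglongrightarrow> 0"
    by (rule LIMSEQ_ignore_initial_segment[OF discount_tendsto_0])
  then show "(\<lambda>k. raw_value greedy h + discount \<gamma> (Suc (length h) + k)) \<longlonglongrightarrow> raw_value greedy h"
    using tendsto_add[OF tendsto_const] by (fastforce simp: add.commute)
  show "\<exists>N. \<forall>n\<ge>N. raw_value \<pi> h \<le> raw_value greedy h + discount \<gamma> (Suc (length h) + n)"
    using raw_value_le_greedy_add by blast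
qed

lemma opt_iter_action_value_search_env:
  "0 < env_prob search_env h \<Longrightarrow> opt_iter_action_value \<gamma> search_env h a = best h a"
  by (simp add: opt_iter_action_value_def iter_action_value_def best_def iter_value_search_env)

lemma iterative_AINU_greedy: "iterative_AINU \<gamma> search_env greedy"
  unfolding iterative_AINU_def
proof (intro allI impI conjI)
  fix h assume h: "0 < env_prob search_env h"
  have "opt_iter_value \<gamma> search_env h = raw_value greedy h / discount \<gamma> (Suc (length h))"
    unfolding opt_iter_value_def iter_value_search_env[OF h]
    by (rule cSup_eq_maximum)
      (auto intro!: divide_right_mono raw_value_le_greedy simp: less_imp_le discount_pos)
  then show "iter_value \<gamma> search_env greedy h = opt_iter_value \<gamma> search_env h"
    using iter_value_search_env[OF h] by simp
  show "greedy h = ActAlpha \<longleftrightarrow> opt_iter_action_value \<gamma> search_env h ActBeta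
      \<le> opt_iter_action_value \<gamma> search_env h ActAlpha"
    unfolding opt_iter_action_value_search_env[OF h] by (simp add: greedy_def)
qed

section \<open>Values after a query, and the reduction\<close>

definition query :: "nat \<Rightarrow> history" where
  "query n = replicate n (ActBeta, False, False) @ [(ActAlpha, False, False)]"

lemma acts_query: "acts (query n) = replicate n ActBeta @ [ActAlpha]"
  by (simp add: query_def)

text \<open>Used to see that a query, which contains a single \<open>ActAlpha\<close>, stays
  uncommitted however many \<open>ActBeta\<close> follow.\<close>

lemma committed_two_alphas: "committed as \<Longrightarrow> 2 \<le> count_list as ActAlpha"
  by (auto simp: committed_def commit_def)

lemma uncommitted_query: "\<not> committed (acts (query n) @ replicate k ActBeta)"
proof -
  have "count_list (replicate m ActBeta) ActAlpha = 0" for m by (induction m) auto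
  then show ?thesis using committed_two_alphas[of "acts (query n) @ replicate k ActBeta"]
    by (auto simp: acts_query)
qed

lemma env_prob_query: "0 < env_prob search_env (query n)"
proof -
  have u: "\<not> committed (acts (query n))" using uncommitted_query[of n 0] by simp
  have "map snd (query n) = replicate (length (query n)) (False, False)"
    by (simp add: query_def replicate_append_same)
  then show ?thesis
    using percepts_uncommitted[OF u] alive_uncommitted[OF u] by (simp add: env_prob_search_env_pos)
qed

text \<open>The action commits to stage 0, where \<open>confirms\<close> always fails, so the
  environment dies at the next step. With ties going to \<open>ActAlpha\<close>, optimality then
  tests whether \<open>ActBeta\<close> has positive value.\<close>

lemma best_query_alpha: "best (query n) ActAlpha = 0"
proof -
  have "raw_value \<pi> (query n) = 0" if "\<pi> (query n) = ActAlpha" for \<pi>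
  proof -
    have *: "acts (query n) @ [\<pi> (query n)] = commit n 0"
      using that by (simp add: acts_query commit_def)
    then have "committed (acts (query n) @ [\<pi> (query n)])"
      unfolding committed_def by (metis append_Nil2)
    moreover have "\<not> alive (commit n 0 @ [ActAlpha])" by (simp add: alive_commit confirms_def)
    ultimately show ?thesis
      using raw_value_committed[of "query n" \<pi>] * by (metis append_assoc)
  qed
  then show ?thesis by (simp add: best_def)
qed

text \<open>A path without commitment earns nothing, so positive value yields a stage
  \<open>i\<close>; survival at all later times then confirms every \<open>j\<close>.\<close>

lemma raw_value_pos_query:
  assumes "\<pi> (query n) = ActBeta" "0 < raw_value \<pi> (query n)"
  shows "\<exists>i. \<forall>j. \<exists>w. confirms n i j w"
proof -
  let ?h = "query n"
  have alive: "alive (acts (path \<pi> ?h k))" for k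
    using assms(2) by (simp add: raw_value_def split: if_splits)
  have "\<exists>k. committed (acts (path \<pi> ?h (Suc k)))"
  proof (rule ccontr)
    assume "\<not> ?thesis"
    then have "raw_value \<pi> ?h = 0" by (simp add: raw_value_def del: path.simps)
    with assms(2) show False by simp
  qed
  then obtain k where "committed (acts (path \<pi> ?h k))" by blast
  then obtain m i s where c: "acts (path \<pi> ?h k) = commit m i @ s" by (auto simp: committed_def)
  obtain bs where "acts (path \<pi> ?h k) = acts ?h @ bs" using acts_path by blast
  with c have m: "m = n"
    by (simp add: acts_query commit_def replicate_beta_alpha_inject)
  have "\<exists>w. confirms n i j w" for j
  proof -
    \<comment> \<open>Playing \<open>Suc j\<close> more steps makes the part after the commitment
      longer than \<open>j\<close>, so that instance \<open>j\<close> has been checked.\<close>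
    obtain cs where "acts (path \<pi> ?h (k + Suc j)) = commit n i @ s @ cs" "length cs = Suc j"
      using acts_path[of \<pi> "path \<pi> ?h k" "Suc j"] c m by (metis path_add append_assoc)
    then show ?thesis using alive[of "k + Suc j"] by (simp add: alive_commit)
  qed
  then show ?thesis by blast
qed

lemma raw_value_pos_query_ex:
  assumes i: "\<And>j. \<exists>w. confirms n i j w"
  shows "\<exists>\<pi>. \<pi> (query n) = ActBeta \<and> 0 < raw_value \<pi> (query n)"
proof -
  let ?h = "query n"
  \<comment> \<open>Looking only at the length of the history, this plays \<open>i\<close> times
    \<open>ActBeta\<close> after the query and then commits.\<close>
  define \<pi> :: policy where "\<pi> g = (if length g < length ?h + i then ActBeta else ActAlpha)" for g
  \<comment> \<open>Stage 0 is never confirmed; positivity of \<open>i\<close> makes the first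
    action \<open>ActBeta\<close>.\<close>
  have "0 < i" using i[of 0] by (auto simp: confirms_def)
  have acts: "acts (path \<pi> ?h l) = acts ?h @ replicate l ActBeta" if "l \<le> i" for l
    using that by (induction l) (simp_all add: path_Suc \<pi>_def replicate_append_same del: path.simps(2))
  let ?g = "path \<pi> ?h i"
  have commit: "acts ?g @ [\<pi> ?g] = commit n i"
    using acts[of i] by (simp add: \<pi>_def commit_def acts_query)
  then have committed: "committed (acts ?g @ [\<pi> ?g])"
    unfolding committed_def by (metis append_Nil2)
  have "\<forall>bs. alive (acts ?g @ [\<pi> ?g] @ bs)"
    unfolding append_assoc[symmetric] commit alive_commit using i by blast
  then have "0 < raw_value \<pi> ?g"
    using raw_value_committed[of ?g \<pi>] committed discount_pos by simp
  moreover have "raw_value \<pi> ?h = raw_value \<pi> ?g"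
    using acts[of i] uncommitted_query by (intro raw_value_path) simp
  moreover have "\<pi> ?h = ActBeta" using \<open>0 < i\<close> by (simp add: \<pi>_def)
  ultimately show ?thesis by auto
qed

lemma iterative_AINU_query:
  assumes "iterative_AINU \<gamma> search_env \<pi>"
  shows "\<pi> (query n) = ActBeta \<longleftrightarrow> (\<exists>i. \<forall>j. \<exists>w. confirms n i j w)"
proof -
  have "\<pi> (query n) = ActAlpha \<longleftrightarrow> best (query n) ActBeta \<le> best (query n) ActAlpha"
    using assms env_prob_query[of n] opt_iter_action_value_search_env[OF env_prob_query]
    by (simp add: iterative_AINU_def)
  then have "\<pi> (query n) = ActBeta \<longleftrightarrow> 0 < best (query n) ActBeta"
    unfolding best_query_alpha by (cases "\<pi> (query n)") auto
  then show ?thesis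
    unfolding best_pos_iff using raw_value_pos_query raw_value_pos_query_ex by blast
qed

lemma computable_query: "computable query"
  unfolding query_def[abs_def] by (intro computable_intros)

lemma Sigma03_hard_iterative_AINU:
  assumes "iterative_AINU \<gamma> search_env \<pi>"
  shows "Sigma03_hard (policy_graph_code \<pi>)"
  unfolding Sigma03_hard_def
proof (intro allI impI)
  fix B assume "Sigma03 B"
  then obtain R p where B: "B = {x. \<exists>i. \<forall>j. \<exists>k. R x i j k}"
    and p: "\<And>x i j k. rec_eval p [x, i, j, k] (if R x i j k then 1 else 0)"
    unfolding Sigma03_def decidable4_def by blast
  define f where "f x = enc (query (prod_encode (recf_code p, x)), ActBeta)" for x
  have "computable (\<lambda>x :: nat. enc (query (enc (recf_code p, x)), ActBeta))"
    by (intro computable_intros computable_compose[OF computable_query])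
  then have "computable f" by (simp add: f_def[abs_def])
  then have "total_recursive1 f" by (simp add: computable_def total_recursive1_def)
  have code: "prod_encode (history_code h, action_code a) = enc (h, a)" for h a
    by (simp add: history_code_def enc_list_def percept_code_def case_prod_unfold enc_prod_def[abs_def])
  have "f x \<in> policy_graph_code \<pi> \<longleftrightarrow> \<pi> (query (prod_encode (recf_code p, x))) = ActBeta" for x
    unfolding policy_graph_code_def code f_def by (auto simp del: enc_prod_def)
  \<comment> \<open>Stages are shifted by one against the outer quantifier of
    \<open>Sigma03\<close>, since stage 0 is the losing move.\<close>
  also have "\<dots> x \<longleftrightarrow> (\<exists>i. 0 < i \<and> (\<forall>j. \<exists>k. R x (i - 1) j k))" for x
    unfolding iterative_AINU_query[OF assms] ex_confirms[of p R, OF p] by blast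
  also have "\<dots> x \<longleftrightarrow> x \<in> B" for x
    unfolding B mem_Collect_eq by (metis diff_Suc_1 zero_less_Suc)
  finally show "many_one_reducible B (policy_graph_code \<pi>)"
    unfolding many_one_reducible_def using \<open>total_recursive1 f\<close> by blast
qed

end

theorem theorem6p22:
  fixes \<gamma> :: "nat \<Rightarrow> real"
  assumes "discount_function \<gamma>"
  shows "\<exists>\<nu> :: env. chronological_semimeasure \<nu> \<and> lower_semicomputable \<nu> \<and>
    (\<exists>\<pi>. iterative_AINU \<gamma> \<nu> \<pi>) \<and>
    (\<forall>\<pi>. iterative_AINU \<gamma> \<nu> \<pi> \<longrightarrow> Sigma03_hard (policy_graph_code \<pi>))"
proof -
  interpret search_value \<gamma> by standard (rule assms)
  show ?thesis
    using chronological_search_env lower_semicomputable_search_env iterative_AINU_greedy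
      Sigma03_hard_iterative_AINU by blast
qed

end
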